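(* Fix $p\in[1,\infty)$. Assume (A1), (A2), (A3) (see context), and assume at least one of: (C1) $\rho_\gamma<+\infty$ for some $\gamma>p+1$, and Condition $C(\alpha)$ holds for some $\alpha>\frac{dp\gamma}{\gamma-1-p}$; (C2) $\rho_{1+p}<+\infty$ and $\mathbb P$ has finite range of dependence; (C3) $\rho_{1+p}<+\infty$, $\mathbb P$ has positive association, and Condition $C(\alpha)$ holds for some $\alpha>dp$. Then $\mathrm E_0[\deg_{\mathrm{DT}(\hat\omega)}(0)^p]<+\infty$. Moreover: (a) if $\mathcal P_0$-a.s. $\sup_{x\sim0}\mathrm E_0[c_{0,x}(\omega)^p\mid\hat\omega]\le C$ for some constant $C\in[0,\infty)$, then $\mathrm E_0[\mu^\omega(0)^p]<+\infty$; (b) if $\mathcal P_0$-a.s. $\sup_{x\sim0}\mathrm E_0[c_{0,x}(\omega)^{-p}\mid\hat\omega]\le C$ for some constant $C\in[0,\infty)$, then $\mathrm E_0[\nu^\omega(0)^p]<+\infty$.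
   Context: $\Lambda_r=[-r,r]^d$. $\mathcal N$ = locally finite subsets of $\mathbb R^d$, identified with counting measures ($\xi(A)=\#(\xi\cap A)$), with $\sigma$-algebra generated by $\xi\mapsto\xi(A)$; $\tau_x\xi:=\xi-x$. $\mathrm{Vor}(x|\xi)=\{y:|y-x|\le|y-z|\ \forall z\in\xi\}$; $\mathrm{DT}(\xi)$ is the graph on $\xi$ with edges $\{x,y\}$, $x\ne y$, whose Voronoi cells share a $(d-1)$-dimensional face; $x\sim y$ denotes adjacency and $\deg_{\mathrm{DT}(\xi)}(x)$ the degree. Setting: $(\Omega,\mathcal F,\mathcal P)$ probability space with a measurable $\mathbb R^d$-action $(\theta_x)$; simple point process $\omega\mapsto\hat\omega\in\mathcal N$ with law $\mathbb P$ (expectation $\mathbb E$); measurable symmetric conductances $c_{x,y}(\omega)\ge0$, $c_{x,x}=0$, $c_{x,y}(\omega)=0$ unless $\{x,y\}$ is an edge of $\mathrm{DT}(\hat\omega)$. (A1) $\mathcal P$ is $\theta$-invariant and $\mathcal P(\hat\omega=\emptyset)=0$; (A2) $m:=\mathbb E[\xi([0,1]^d)]\in(0,\infty)$; (A3) on a $\theta$-invariant measurable full-measure set $\Omega_*$, $\widehat{\theta_x\omega}=\tau_x\hat\omega$ and $c_{y-x,z-x}(\theta_x\omega)=c_{y,z}(\omega)$ for all $x$ and edges $\{y,z\}$ of $\mathrm{DT}(\hat\omega)$. Palm distribution $\mathcal P_0(A)=\frac1m\int d\mathcal P(\omega)\sum_{x\in\hat\omega\cap[0,1]^d}\mathbf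 1_A(\theta_x\omega)$, concentrated on $\{0\in\hat\omega\}$, expectation $\mathrm E_0$. For $0\in\hat\omega$: $\mu^\omega(0):=\sum_{x\sim0}c_{0,x}(\omega)$, $\nu^\omega(0):=\sum_{x\sim0}1/c_{0,x}(\omega)$. $\rho_\gamma:=\mathbb E[\xi([0,1]^d)^\gamma]$. Condition $C(\alpha)$: $\exists\kappa>0$ with $\mathbb P(\xi(\Lambda_\ell)=0)\le\kappa\ell^{-\alpha}$ for all $\ell\ge1$. Finite range of dependence: $\exists L>0$ such that $\xi\cap A$ and $\xi\cap B$ are $\mathbb P$-independent for Borel $A,B$ at Euclidean distance $\ge L$. Positive association: $\mathrm{Cov}_{\mathbb P}(f(\xi(A_1),\dots,\xi(A_n)),g(\xi(B_1),\dots,\xi(B_k)))\ge0$ for all weakly increasing $f,g$ and pairwise disjoint bounded Borel sets, whenever both have finite second moments. *)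

theory Defs
  imports "HOL-Probability.Probability"
begin

definition Lam :: "real \<Rightarrow> 'a::euclidean_space set" where
  "Lam r = cbox (- (r *\<^sub>R One)) (r *\<^sub>R One)"

definition unit_cube :: "'a::euclidean_space set" where
  "unit_cube = cbox 0 One"

definition locfin :: "'a::euclidean_space set \<Rightarrow> bool" where
  "locfin \<xi> \<longleftrightarrow> (\<forall>B. bounded B \<longrightarrow> finite (\<xi> \<inter> B))"

definition npts :: "'a set \<Rightarrow> 'a set \<Rightarrow> ennreal" where
  "npts \<xi> A = (if finite (\<xi> \<inter> A) then of_nat (card (\<xi> \<inter> A)) else \<infinity>)"

definition Nspace :: "'a::euclidean_space set measure" where
  "Nspace = sigma (Collect locfin)
     {{\<xi> \<in> Collect locfin. npts \<xi> A = of_nat k} | A k. A \<in> sets borel}"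

definition Vor :: "'a::euclidean_space \<Rightarrow> 'a set \<Rightarrow> 'a set" where
  "Vor x \<xi> = {y. \<forall>z\<in>\<xi>. dist y x \<le> dist y z}"

definition dt_edge :: "'a::euclidean_space set \<Rightarrow> 'a \<Rightarrow> 'a \<Rightarrow> bool" where
  "dt_edge \<xi> x y \<longleftrightarrow> x \<in> \<xi> \<and> y \<in> \<xi> \<and> x \<noteq> y \<and>
     aff_dim (Vor x \<xi> \<inter> Vor y \<xi>) = int DIM('a) - 1"

definition dt_nbrs :: "'a::euclidean_space set \<Rightarrow> 'a \<Rightarrow> 'a set" where
  "dt_nbrs \<xi> x = {y. dt_edge \<xi> x y}"

definition dt_deg :: "'a::euclidean_space set \<Rightarrow> 'a \<Rightarrow> ennreal" where
  "dt_deg \<xi> x = (if finite (dt_nbrs \<xi> x) then of_nat (card (dt_nbrs \<xi> x)) else \<infinity>)"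

definition epow :: "ennreal \<Rightarrow> real \<Rightarrow> ennreal" where
  "epow x q = (if x = \<infinity> then \<infinity> else ennreal (enn2real x powr q))"

definition esum :: "'a set \<Rightarrow> ('a \<Rightarrow> ennreal) \<Rightarrow> ennreal" where
  "esum S f = (\<integral>\<^sup>+ x. indicator S x * f x \<partial>count_space UNIV)"

definition intensity :: "'w measure \<Rightarrow> ('w \<Rightarrow> 'a::euclidean_space set) \<Rightarrow> ennreal" where
  "intensity M pp = (\<integral>\<^sup>+ \<omega>. npts (pp \<omega>) unit_cube \<partial>M)"

definition palm :: "'w measure \<Rightarrow> ('w \<Rightarrow> 'a::euclidean_space set) \<Rightarrow> ('a \<Rightarrow> 'w \<Rightarrow> 'w) \<Rightarrow> 'w measure" where
  "palm M pp \<theta> = measure_of (space M) (sets M)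
     (\<lambda>A. (\<integral>\<^sup>+ \<omega>. (\<Sum>x\<in>pp \<omega> \<inter> unit_cube. indicator A (\<theta> x \<omega>)) \<partial>M) / intensity M pp)"

definition rho :: "'w measure \<Rightarrow> ('w \<Rightarrow> 'a::euclidean_space set) \<Rightarrow> real \<Rightarrow> ennreal" where
  "rho M pp \<gamma> = (\<integral>\<^sup>+ \<omega>. epow (npts (pp \<omega>) unit_cube) \<gamma> \<partial>M)"

definition cond_C :: "'w measure \<Rightarrow> ('w \<Rightarrow> 'a::euclidean_space set) \<Rightarrow> real \<Rightarrow> bool" where
  "cond_C M pp \<alpha> \<longleftrightarrow> (\<exists>\<kappa>>0. \<forall>l\<ge>1.
     measure M {\<omega>\<in>space M. npts (pp \<omega>) (Lam l) = 0} \<le> \<kappa> * l powr (- \<alpha>))"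

definition finite_range_dep :: "'w measure \<Rightarrow> ('w \<Rightarrow> 'a::euclidean_space set) \<Rightarrow> bool" where
  "finite_range_dep M pp \<longleftrightarrow> (\<exists>L>0. \<forall>A B. A \<in> sets borel \<longrightarrow> B \<in> sets borel \<longrightarrow>
     (\<forall>a\<in>A. \<forall>b\<in>B. L \<le> dist a b) \<longrightarrow>
     prob_space.indep_var M Nspace (\<lambda>\<omega>. pp \<omega> \<inter> A) Nspace (\<lambda>\<omega>. pp \<omega> \<inter> B))"

definition mono_list_fun :: "nat \<Rightarrow> (nat list \<Rightarrow> real) \<Rightarrow> bool" where
  "mono_list_fun n f \<longleftrightarrow> (\<forall>xs ys. length xs = n \<longrightarrow> length ys = n \<longrightarrow>
     list_all2 (\<le>) xs ys \<longrightarrow> f xs \<le> f ys)"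

definition pos_assoc :: "'w measure \<Rightarrow> ('w \<Rightarrow> 'a::euclidean_space set) \<Rightarrow> bool" where
  "pos_assoc M pp \<longleftrightarrow> (\<forall>As Bs f g.
     (\<forall>A\<in>set (As @ Bs). A \<in> sets borel \<and> bounded A) \<longrightarrow>
     (\<forall>i<length (As @ Bs). \<forall>j<length (As @ Bs). i \<noteq> j \<longrightarrow> (As @ Bs) ! i \<inter> (As @ Bs) ! j = {}) \<longrightarrow>
     mono_list_fun (length As) f \<longrightarrow> mono_list_fun (length Bs) g \<longrightarrow>
     (let X = (\<lambda>\<omega>. f (map (\<lambda>A. card (pp \<omega> \<inter> A)) As));
          Y = (\<lambda>\<omega>. g (map (\<lambda>B. card (pp \<omega> \<inter> B)) Bs)) in
      integrable M (\<lambda>\<omega>. (X \<omega>)\<^sup>2) \<longrightarrow> integrable M (\<lambda>\<omega>. (Y \<omega>)\<^sup>2) \<longrightarrow>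
      0 \<le> (\<integral>\<omega>. X \<omega> * Y \<omega> \<partial>M) - (\<integral>\<omega>. X \<omega> \<partial>M) * (\<integral>\<omega>. Y \<omega> \<partial>M)))"

text \<open>Bound on conditional expectations given hat omega of a field (f omega x) indexed by the
  neighbours x of 0: there is a version g(omega,x) of E_0[f(.,x) | hat omega], i.e. a function
  measurable w.r.t. sigma(hat omega) \<otimes> Borel satisfying the defining property
  E_0[sum_{x~0} h(omega,x) f(omega,x)] = E_0[sum_{x~0} h(omega,x) g(omega,x)] for all nonnegative
  sigma(hat omega) \<otimes> Borel measurable h, such that P_0-a.s. sup_{x~0} g(omega,x) \<le> C.\<close>
definition cond_exp_nbr_bounded ::
  "'w measure \<Rightarrow> 'w measure \<Rightarrow> ('w \<Rightarrow> 'a set) \<Rightarrow> ('w \<Rightarrow> 'a::euclidean_space set)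
     \<Rightarrow> ('w \<Rightarrow> 'a \<Rightarrow> ennreal) \<Rightarrow> real \<Rightarrow> bool" where
  "cond_exp_nbr_bounded P0 F nb pp f C \<longleftrightarrow>
     (\<exists>g::'w \<Rightarrow> 'a \<Rightarrow> ennreal.
        (\<lambda>(\<omega>, x). g \<omega> x) \<in> borel_measurable (F \<Otimes>\<^sub>M borel) \<and>
        (\<forall>h::'w \<Rightarrow> 'a \<Rightarrow> ennreal. (\<lambda>(\<omega>, x). h \<omega> x) \<in> borel_measurable (F \<Otimes>\<^sub>M borel) \<longrightarrow>
           (\<integral>\<^sup>+ \<omega>. esum (nb \<omega>) (\<lambda>x. h \<omega> x * f \<omega> x) \<partial>P0) =
           (\<integral>\<^sup>+ \<omega>. esum (nb \<omega>) (\<lambda>x. h \<omega> x * g \<omega> x) \<partial>P0)) \<and>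
        (AE \<omega> in P0. \<forall>x\<in>nb \<omega>. g \<omega> x \<le> ennreal C))"

end

theory Submission
  imports Defs
begin

text \<open>If every cube of a fixed finite grid at scale \<open>R\<close> around \<open>0\<close> meets \<open>\<xi>\<close>, then \<open>Vor(0|\<xi>)\<close> lies in
  \<open>\<Lambda>\<^sub>R\<close>, so all neighbours of \<open>0\<close> lie in a cube of comparable size. Hence the \<open>p\<close>-th power of
  the degree is at most a sum over dyadic scales \<open>R\<close> of the \<open>p\<close>-th power of the number of points in
  \<open>\<Lambda>\<^bsub>O(R)\<^esub>\<close>, each term being present only if some grid cube at the preceding scale is empty. Covering
  \<open>\<Lambda>\<^bsub>O(R)\<^esub>\<close> by \<open>O(R^d)\<close> unit cubes and using Jensen, the Palm expectation is finite as soon as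
  \<open>E[\<xi>(Q)^(p+1); \<xi>(G) = 0] = O(R^-\<beta>)\<close> with \<open>\<beta> > d p\<close>, uniformly in unit cubes \<open>Q\<close> and cubes \<open>G\<close> of
  size \<open>R\<close>. Under (C1) this is a truncation of \<open>\<xi>(Q)\<close>. Under (C2) and (C3) one replaces \<open>G\<close> by a subcube
  far from \<open>Q\<close> and the two factors decouple; finite range makes void probabilities decay
  exponentially. The bounds on \<open>\<mu>\<close> and \<open>\<nu>\<close> follow by Jensen, with the same dominating function of \<open>\<xi>\<close>
  as test function in the conditional expectation.\<close>

subsection \<open>Inequalities for extended sums and the Palm measure\<close>

text \<open>Jensen's inequality with uniform weights. Terms equal to zero are discarded first, so
  that convexity of the power on the positive reals suffices; enlarging \<open>T\<close> back to
  \<open>S\<close> can only increase the prefactor because p - 1 is nonnegative.\<close>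

lemma powr_sum_le:
  fixes f :: "'b \<Rightarrow> real"
  assumes "finite S" "1 \<le> p" "\<And>x. x \<in> S \<Longrightarrow> 0 \<le> f x"
  shows "(\<Sum>x\<in>S. f x) powr p \<le> real (card S) powr (p - 1) * (\<Sum>x\<in>S. f x powr p)"
proof -
  define T where "T = {x\<in>S. f x \<noteq> 0}"
  have fT: "finite T" and TS: "T \<subseteq> S" using assms by (auto simp: T_def)
  have pos: "0 < f x" if "x \<in> T" for x using that assms(3)[of x] by (auto simp: T_def)
  have e1: "(\<Sum>x\<in>S. f x) = (\<Sum>x\<in>T. f x)"
    by (rule sum.mono_neutral_right[OF assms(1) TS]) (auto simp: T_def)
  have e2: "(\<Sum>x\<in>S. f x powr p) = (\<Sum>x\<in>T. f x powr p)"
    by (rule sum.mono_neutral_right[OF assms(1) TS]) (auto simp: T_def)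
  show ?thesis
  proof (cases "T = {}")
    case True
    then show ?thesis by (simp add: e1 e2)
  next
    case False
    let ?n = "real (card T)"
    have n: "?n > 0" using False fT by (simp add: card_gt_0_iff)
    have "(\<Sum>x\<in>T. (1 / ?n) *\<^sub>R f x) powr p \<le> (\<Sum>x\<in>T. (1 / ?n) * f x powr p)"
      by (rule convex_on_sum[OF fT False powr_convex[OF assms(2)]]) (use n pos in auto)
    then have "((\<Sum>x\<in>T. f x) / ?n) powr p \<le> (\<Sum>x\<in>T. f x powr p) / ?n"
      by (simp add: sum_divide_distrib)
    then have "(\<Sum>x\<in>T. f x) powr p / ?n powr p \<le> (\<Sum>x\<in>T. f x powr p) / ?n"
      using n pos by (subst (asm) powr_divide) (auto intro!: sum_nonneg less_imp_le)
    then have "(\<Sum>x\<in>T. f x) powr p \<le> (\<Sum>x\<in>T. f x powr p) * (?n powr p / ?n)"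
      using n by (simp add: field_simps)
    also have "?n powr p / ?n = ?n powr (p - 1)"
      using n by (simp add: powr_diff)
    also have "(\<Sum>x\<in>T. f x powr p) * ?n powr (p - 1)
        \<le> (\<Sum>x\<in>T. f x powr p) * real (card S) powr (p - 1)"
      using n assms(1,2) TS by (intro mult_left_mono powr_mono2 sum_nonneg) (auto intro: card_mono)
    finally show ?thesis by (simp add: e1 e2 mult.commute)
  qed
qed

text \<open>Replace the smaller of the two numbers by the larger. This separates the product of
  counts in two different cubes into moments of single cubes, at the price of the exponent p +
  1.\<close>

lemma mult_powr_le:
  fixes x y p :: real
  assumes "0 \<le> x" "0 \<le> y" "1 \<le> p"
  shows "x * y powr p \<le> x powr (p + 1) + y powr (p + 1)"
proof (cases "x \<le> y")
  case True
  have "x * y powr p \<le> y * y powr p" using True by (intro mult_right_mono) auto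
  also have "\<dots> = y powr (p + 1)" using assms by (cases "y = 0") (simp_all add: powr_add)
  finally show ?thesis by (simp add: add_increasing)
next
  case False
  have "x * y powr p \<le> x * x powr p"
    using False assms by (intro mult_left_mono powr_mono2) auto
  also have "\<dots> = x powr (p + 1)" using assms by (cases "x = 0") (simp_all add: powr_add)
  finally show ?thesis by (simp add: add_increasing2)
qed

section \<open>Powers of extended nonnegative reals\<close>

lemma epow_ennreal: "0 \<le> r \<Longrightarrow> epow (ennreal r) q = ennreal (r powr q)"
  by (simp add: epow_def)

lemma epow_top [simp]: "epow top q = top"
  by (simp add: epow_def)

lemma epow_0 [simp]: "epow 0 q = 0"
  by (simp add: epow_def)

lemma epow_of_nat: "epow (of_nat n) q = ennreal (real n powr q)"
  by (metis epow_ennreal ennreal_of_nat_eq_real_of_nat of_nat_0_le_iff)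

lemma epow_mono:
  assumes "x \<le> y" "0 \<le> q"
  shows "epow x q \<le> epow y q"
proof (cases "y = \<infinity>")
  case True
  then show ?thesis by (simp add: epow_def)
next
  case False
  then show ?thesis using assms
    by (cases x; cases y) (auto simp: epow_ennreal top_unique intro!: ennreal_leI powr_mono2)
qed

lemma epow_measurable [measurable]: "(\<lambda>x. epow x q) \<in> borel_measurable borel"
  unfolding epow_def by measurable

text \<open>In the application \<open>W\<close> bounds \<open>card S ^ p\<close>; the weight \<open>W ^ ((p - 1) / p)\<close> stands in for
  \<open>card S ^ (p - 1)\<close>, whose measurability is then never needed.\<close>

lemma epow_esum_le:
  fixes f :: "'b \<Rightarrow> ennreal"
  assumes p: "1 \<le> p"
    and W: "epow (if finite S then of_nat (card S) else \<infinity>) p \<le> W"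
  shows "epow (esum S f) p \<le> esum S (\<lambda>x. epow W ((p - 1) / p) * epow (f x) p)"
proof -
  let ?w = "epow W ((p - 1) / p)"
  consider (zero) "\<forall>x\<in>S. f x = 0" | (inf) "\<exists>x\<in>S. f x \<noteq> 0" "W = \<infinity>"
    | (ftop) x where "W \<noteq> \<infinity>" "x \<in> S" "f x = \<infinity>"
    | (fin) "W \<noteq> \<infinity>" "\<forall>x\<in>S. f x \<noteq> \<infinity>" "S \<noteq> {}" by blast
  then show ?thesis
  proof cases
    case zero
    then have "(\<lambda>x. indicator S x * f x) = (\<lambda>x. 0)" by (auto simp: indicator_def)
    then have "esum S f = 0" unfolding esum_def by simp
    then show ?thesis by simp
  next
    case inf
    then obtain x where x: "x \<in> S" "f x \<noteq> 0" by blast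
    have "epow (f x) p \<noteq> 0"
      using x by (cases "f x") (auto simp: epow_ennreal ennreal_eq_0_iff)
    \<comment> \<open>\<open>epow\<close> sends infinity to infinity for every exponent, including
      the exponent 0 that occurs when p = 1.\<close>
    then have "top = indicator S x * (?w * epow (f x) p)" using x inf by (simp add: ennreal_mult_top ennreal_top_mult)
    also have "\<dots> \<le> esum S (\<lambda>x. ?w * epow (f x) p)"
      unfolding esum_def by (rule nn_integral_ge_point) simp
    finally show ?thesis by (simp add: top_unique)
  next
    case ftop
    have finS: "finite S" using W ftop by (auto simp: epow_def top_unique split: if_splits)
    \<comment> \<open>A vanishing weight would annihilate the infinite term, since 0 times infinity
      is 0. It is excluded because \<open>S\<close> is nonempty and hence \<open>W\<close> is
      positive.\<close>
    have "?w \<noteq> 0"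
    proof
      assume "?w = 0"
      then have "W = 0" using ftop by (cases W) (auto simp: epow_ennreal ennreal_eq_0_iff)
      then have "ennreal (real (card S) powr p) = 0" using W finS by (simp add: epow_of_nat)
      then show False using ftop finS by (auto simp: ennreal_eq_0_iff)
    qed
    then have "top = indicator S x * (?w * epow (f x) p)" using ftop by (simp add: ennreal_mult_top)
    also have "\<dots> \<le> esum S (\<lambda>x. ?w * epow (f x) p)"
      unfolding esum_def by (rule nn_integral_ge_point) simp
    finally show ?thesis by (simp add: top_unique)
  next
    case fin
    have finS: "finite S" using W fin by (auto simp: epow_def top_unique split: if_splits)
    obtain w where w: "W = ennreal w" "0 \<le> w" using fin by (cases W) auto
    have esum: "esum S h = (\<Sum>x\<in>S. h x)" for h
      unfolding esum_def
      by (subst nn_integral_count_space'[OF finS]) (auto simp: indicator_def)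
    define g where "g x = enn2real (f x)" for x
    have g: "f x = ennreal (g x)" if "x \<in> S" for x
      using fin that by (auto simp: g_def less_top)
    have g0: "0 \<le> g x" for x by (simp add: g_def)
    have "real (card S) powr p \<le> w"
      using W finS w by (simp add: epow_of_nat)
    then have "(real (card S) powr p) powr ((p - 1) / p) \<le> w powr ((p - 1) / p)"
      using p by (intro powr_mono2) auto
    then have le: "real (card S) powr (p - 1) \<le> w powr ((p - 1) / p)"
      using p by (simp add: powr_powr)
    have "esum S f = ennreal (\<Sum>x\<in>S. g x)"
      by (simp add: esum g g0 cong: sum.cong)
    then have "epow (esum S f) p = ennreal ((\<Sum>x\<in>S. g x) powr p)"
      by (simp add: epow_ennreal sum_nonneg g0)
    also have "\<dots> \<le> ennreal (real (card S) powr (p - 1) * (\<Sum>x\<in>S. g x powr p))"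
      by (intro ennreal_leI powr_sum_le finS p g0)
    also have "\<dots> \<le> ennreal (w powr ((p - 1) / p) * (\<Sum>x\<in>S. g x powr p))"
      by (intro ennreal_leI mult_right_mono le sum_nonneg) auto
    also have "\<dots> = (\<Sum>x\<in>S. ennreal (w powr ((p - 1) / p)) * ennreal (g x powr p))"
      by (simp add: sum_distrib_left ennreal_mult flip: sum_ennreal)
    also have "\<dots> = esum S (\<lambda>x. ?w * epow (f x) p)"
      using w g0 by (simp add: esum epow_ennreal g cong: sum.cong)
    finally show ?thesis .
  qed
qed

text \<open>The cardinality is at most W^(1/p), and the exponents 1/p and (p - 1)/p add up to 1. So
  the weights of the previous lemma, summed against a constant, return \<open>W\<close>
  itself.\<close>

lemma card_mult_epow_le:
  assumes p: "1 \<le> p"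
    and W: "epow (if finite S then of_nat (card S) else \<infinity>) p \<le> W"
  shows "esum S (\<lambda>x. epow W ((p - 1) / p) * C) \<le> C * W"
proof (cases "S = {} \<or> C = 0")
  case True
  then show ?thesis by (auto simp: esum_def)
next
  case False
  show ?thesis
  proof (cases "W = \<infinity>")
    case True
    then show ?thesis using False by (simp add: ennreal_mult_top)
  next
    case fin: False
    have finS: "finite S" using W fin by (auto simp: epow_def top_unique split: if_splits)
    obtain w where w: "W = ennreal w" "0 \<le> w" using fin by (cases W) auto
    have cw: "real (card S) powr p \<le> w"
      using W finS w by (simp add: epow_of_nat)
    have "card S > 0" using False finS by (simp add: card_gt_0_iff)
    then have w0: "w > 0" using cw by (smt (verit) of_nat_0_less_iff powr_gt_zero)
    have "(real (card S) powr p) powr (1 / p) \<le> w powr (1 / p)"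
      using p cw by (intro powr_mono2) auto
    then have le: "real (card S) \<le> w powr (1 / p)"
      using p by (simp add: powr_powr)
    have "esum S (\<lambda>x. epow W ((p - 1) / p) * C) = of_nat (card S) * (ennreal (w powr ((p - 1) / p)) * C)"
      unfolding esum_def
      by (subst nn_integral_count_space'[OF finS]) (auto simp: indicator_def w epow_ennreal)
    also have "\<dots> = ennreal (real (card S) * w powr ((p - 1) / p)) * C"
      by (simp add: ennreal_mult ennreal_of_nat_eq_real_of_nat mult.assoc)
    also have "\<dots> \<le> ennreal (w powr (1 / p) * w powr ((p - 1) / p)) * C"
      using le by (intro mult_right_mono ennreal_leI) auto
    also have "w powr (1 / p) * w powr ((p - 1) / p) = w"
      using p w0 by (simp add: add_divide_distrib[symmetric] flip: powr_add)
    finally show ?thesis by (simp add: w mult.commute)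
  qed
qed

section \<open>Lower integrals and integration against the Palm measure\<close>

lemma nn_integral_superadditive:
  "(\<integral>\<^sup>+x. f x \<partial>M) + (\<integral>\<^sup>+x. g x \<partial>M) \<le> (\<integral>\<^sup>+x. f x + g x \<partial>M)"
proof -
  \<comment> \<open>Simple minorants of \<open>f\<close> and \<open>g\<close> add up to a minorant
    of the sum. This direction uses no measurability of \<open>f\<close> or
    \<open>g\<close>.\<close>
  have *: "integral\<^sup>S M s + integral\<^sup>S M t \<le> (\<integral>\<^sup>+x. f x + g x \<partial>M)"
    if "simple_function M s" "s \<le> f" "simple_function M t" "t \<le> g" for s t
  proof -
    have "integral\<^sup>S M s + integral\<^sup>S M t = (\<integral>\<^sup>+x. s x + t x \<partial>M)"
      using that by (subst nn_integral_add) (auto simp: nn_integral_eq_simple_integral borel_measurable_simple_function)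
    also have "\<dots> \<le> (\<integral>\<^sup>+x. f x + g x \<partial>M)"
      using that by (intro nn_integral_mono add_mono) (auto simp: le_fun_def)
    finally show ?thesis .
  qed
  have ne: "{s. simple_function M s \<and> s \<le> h} \<noteq> {}" for h :: "'a \<Rightarrow> ennreal"
    by (auto intro!: exI[of _ "\<lambda>_. 0"] simp: le_fun_def)
  have **: "integral\<^sup>S M s + integral\<^sup>N M g \<le> (\<integral>\<^sup>+x. f x + g x \<partial>M)"
    if "simple_function M s" "s \<le> f" for s
    unfolding nn_integral_def[of M g]
    by (subst ennreal_SUP_add_right[OF ne]) (auto intro!: SUP_least * that)
  show ?thesis
    unfolding nn_integral_def[of M f]
    by (subst ennreal_SUP_add_left[symmetric, OF ne]) (auto intro!: SUP_least **)
qed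

lemma nn_integral_cmult_le: "c * (\<integral>\<^sup>+x. f x \<partial>M) \<le> (\<integral>\<^sup>+x. c * f x \<partial>M)"
proof -
  have "c * integral\<^sup>S M s \<le> (\<integral>\<^sup>+x. c * f x \<partial>M)" if "simple_function M s" "s \<le> f" for s
  proof -
    have "c * integral\<^sup>S M s = (\<integral>\<^sup>+x. c * s x \<partial>M)"
      using that by (subst nn_integral_cmult) (auto simp: nn_integral_eq_simple_integral borel_measurable_simple_function)
    also have "\<dots> \<le> (\<integral>\<^sup>+x. c * f x \<partial>M)"
      using that by (intro nn_integral_mono mult_left_mono) (auto simp: le_fun_def)
    finally show ?thesis .
  qed
  then show ?thesis
    unfolding nn_integral_def[of M f] by (subst SUP_mult_left_ennreal) (auto intro!: SUP_least)
qed

text \<open>The integrand on the right need not be measurable, and \<open>palm\<close> need not be a measure a priori;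
  superadditivity of the lower integral is enough for this inequality.\<close>

lemma nn_integral_palm_le:
  assumes f: "f \<in> borel_measurable M"
    and theta: "\<And>x \<omega>. \<omega> \<in> space M \<Longrightarrow> \<theta> x \<omega> \<in> space M"
  shows "(\<integral>\<^sup>+\<omega>. f \<omega> \<partial>palm M pp \<theta>)
    \<le> (\<integral>\<^sup>+\<omega>. (\<Sum>x\<in>pp \<omega> \<inter> unit_cube. f (\<theta> x \<omega>)) \<partial>M) / intensity M pp"
    (is "_ \<le> ?R f")
proof -
  let ?P = "palm M pp \<theta>"
  have sets: "sets ?P = sets M" and space: "space ?P = space M"
    by (auto simp: palm_def sets.space_closed)
  have meas: "borel_measurable ?P = borel_measurable M"
    by (rule measurable_cong_sets) (auto simp: sets)
  show ?thesis
    using f[folded meas]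
  proof (induct rule: borel_measurable_induct)
    case (cong f g)
    have "integral\<^sup>N ?P f = integral\<^sup>N ?P g" by (rule nn_integral_cong) (use cong in auto)
    also have "\<dots> \<le> ?R g" by fact
    also have "?R g = ?R f"
      using cong(3) theta space
      by (intro arg_cong2[where f = divide] nn_integral_cong sum.cong refl) auto
    finally show ?case .
  next
    case (set A)
    then have "integral\<^sup>N ?P (indicator A) = emeasure ?P A" by (simp add: nn_integral_indicator)
    \<comment> \<open>\<open>measure_of\<close> returns the defining set function if that is a
      measure and 0 otherwise; the inequality holds in either case.\<close>
    also have "\<dots> \<le> ?R (indicator A)"
      unfolding palm_def by (subst emeasure_measure_of_conv) (auto simp: sets.space_closed)
    finally show ?case .
  next
    case (mult u c)
    have "(\<integral>\<^sup>+x. c * u x \<partial>?P) = c * integral\<^sup>N ?P u" by (rule nn_integral_cmult) (use mult in auto)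
    also have "\<dots> \<le> c * ?R u" using mult by (intro mult_left_mono) auto
    also have "\<dots> \<le> ?R (\<lambda>x. c * u x)"
      unfolding ennreal_times_divide sum_distrib_left[symmetric]
      by (intro divide_right_mono_ennreal nn_integral_cmult_le)
    finally show ?case .
  next
    case (add u v)
    have "(\<integral>\<^sup>+x. v x + u x \<partial>?P) = integral\<^sup>N ?P v + integral\<^sup>N ?P u"
      by (rule nn_integral_add) (use add in auto)
    also have "\<dots> \<le> ?R v + ?R u" using add by (intro add_mono) auto
    also have "\<dots> \<le> ?R (\<lambda>x. v x + u x)"
      unfolding sum.distrib divide_ennreal_def distrib_right[symmetric]
      by (intro mult_right_mono nn_integral_superadditive) auto
    finally show ?case .
  next
    case (seq U)
    have "integral\<^sup>N ?P (SUP i. U i) = (SUP i. integral\<^sup>N ?P (U i))"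
      unfolding image_comp SUP_apply by (rule nn_integral_monotone_convergence_SUP) (use seq in auto)
    \<comment> \<open>On the right only monotonicity in \<open>i\<close> is used, so no convergence
      theorem is applied to a possibly non-measurable integrand.\<close>
    also have "\<dots> \<le> ?R (SUP i. U i)"
    proof (rule SUP_least)
      fix i
      have "integral\<^sup>N ?P (U i) \<le> ?R (U i)" by fact
      also have "\<dots> \<le> ?R (SUP i. U i)"
        by (intro divide_right_mono_ennreal nn_integral_mono sum_mono)
          (auto intro: SUP_upper)
      finally show "integral\<^sup>N ?P (U i) \<le> ?R (SUP i. U i)" .
    qed
    finally show ?case .
  qed
qed

subsection \<open>Cubes and Voronoi cells\<close>

text \<open>The closed ball of the maximum norm. Both \<open>Lam r\<close> and
  \<open>unit_cube\<close> take this form, so a unit cube is always written with radius 1/2 around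
  its midpoint.\<close>

definition cube :: "'a::euclidean_space \<Rightarrow> real \<Rightarrow> 'a set" where
  "cube y r = cbox (y - r *\<^sub>R One) (y + r *\<^sub>R One)"

lemma mem_cube: "z \<in> cube y r \<longleftrightarrow> (\<forall>b\<in>Basis. \<bar>z \<bullet> b - y \<bullet> b\<bar> \<le> r)"
  by (force simp: cube_def mem_box inner_diff_left inner_add_left abs_le_iff)

lemma Lam_eq_cube: "Lam r = cube 0 r"
  by (simp add: Lam_def cube_def)

lemma unit_cube_eq_cube: "unit_cube = cube ((1/2) *\<^sub>R One) (1/2)"
  by (simp add: unit_cube_def cube_def flip: scaleR_add_left)

lemma bounded_cube [simp]: "bounded (cube y r)"
  unfolding cube_def by (rule bounded_cbox)

lemma borel_cube [measurable, simp]: "cube y r \<in> sets borel"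
  unfolding cube_def by (rule borel_closed[OF closed_cbox])

lemma cube_mono: "r \<le> s \<Longrightarrow> cube y r \<subseteq> cube y s"
  by (fastforce simp: mem_cube intro: order_trans)

lemma translate_cube: "(\<lambda>z. z - x) ` S \<inter> cube y r = (\<lambda>z. z - x) ` (S \<inter> cube (y + x) r)"
proof -
  have "z - x \<in> cube y r \<longleftrightarrow> z \<in> cube (y + x) r" for z
  proof -
    have "(z - x) \<bullet> b - y \<bullet> b = z \<bullet> b - (y + x) \<bullet> b" for b
      by (simp add: inner_diff_left inner_add_left)
    then show ?thesis by (simp only: mem_cube)
  qed
  then show ?thesis by auto
qed

lemma locfin_finite: "locfin \<xi> \<Longrightarrow> bounded B \<Longrightarrow> finite (\<xi> \<inter> B)"
  by (simp add: locfin_def)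

lemma card_translate_cube:
  "card ((\<lambda>z. z - x) ` S \<inter> cube y r) = card (S \<inter> cube (y + x) r)"
  unfolding translate_cube by (rule card_image) (auto simp: inj_on_def)

text \<open>Induction by halving: a cube of radius 2h is the union of 2^d cubes of radius h whose
  centres are displaced by h or -h in each coordinate, so the number of unit cubes grows by the
  factor 2^d per step.\<close>

lemma cube_dyadic_cover:
  "\<exists>I::'a::euclidean_space set. finite I \<and> card I \<le> 2 ^ (DIM('a) * n) \<and>
     cube (y::'a) (2 ^ n / 2) \<subseteq> (\<Union>z\<in>I. cube z (1/2))"
proof (induction n arbitrary: y)
  case 0
  show ?case by (intro exI[of _ "{y}"]) auto
next
  case (Suc n)
  define h :: real where "h = 2 ^ n / 2"
  \<comment> \<open>A sign pattern is encoded by the set \<open>B\<close> of coordinates with a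
    positive sign.\<close>
  define s :: "'a set \<Rightarrow> 'a" where "s B = (\<Sum>b\<in>Basis. (if b \<in> B then h else - h) *\<^sub>R b)" for B
  have s: "s B \<bullet> b = (if b \<in> B then h else - h)" if "b \<in> Basis" for B b
    using that by (simp add: s_def)
  obtain I where I: "\<And>y::'a. finite (I y)" "\<And>y. card (I y) \<le> 2 ^ (DIM('a) * n)"
    "\<And>y. cube y h \<subseteq> (\<Union>z\<in>I y. cube z (1/2))"
  proof -
    have "\<forall>y::'a. \<exists>I. finite I \<and> card I \<le> 2 ^ (DIM('a) * n) \<and> cube y h \<subseteq> (\<Union>z\<in>I. cube z (1/2))"
      unfolding h_def using Suc by (rule allI)
    from choice[OF this] show ?thesis using that by auto
  qed
  let ?I = "\<Union>B\<in>Pow (Basis::'a set). I (y + s B)"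
  have "card ?I \<le> (\<Sum>B\<in>Pow (Basis::'a set). card (I (y + s B)))"
    by (rule card_UN_le) simp
  also have "\<dots> \<le> (\<Sum>B\<in>Pow (Basis::'a set). 2 ^ (DIM('a) * n))"
    by (intro sum_mono I)
  also have "\<dots> = 2 ^ (DIM('a) * Suc n)"
    by (simp add: card_Pow power_add)
  finally have card: "card ?I \<le> 2 ^ (DIM('a) * Suc n)" .
  have "cube y (2 ^ Suc n / 2) \<subseteq> (\<Union>z\<in>?I. cube z (1/2))"
  proof
    fix z assume z: "z \<in> cube y (2 ^ Suc n / 2)"
    define B where "B = {b\<in>Basis. z \<bullet> b \<ge> y \<bullet> b}"
    have "z \<in> cube (y + s B) h"
      unfolding mem_cube
    proof
      fix b :: 'a assume b: "b \<in> Basis"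
      have "\<bar>z \<bullet> b - y \<bullet> b\<bar> \<le> 2 * h" using z b by (simp add: mem_cube h_def)
      then show "\<bar>z \<bullet> b - (y + s B) \<bullet> b\<bar> \<le> h"
        using b by (cases "b \<in> B") (auto simp: inner_add_left s B_def abs_le_iff)
    qed
    then obtain w where "w \<in> I (y + s B)" "z \<in> cube w (1/2)" using I(3) by blast
    moreover have "B \<in> Pow Basis" by (auto simp: B_def)
    ultimately show "z \<in> (\<Union>z\<in>?I. cube z (1/2))" by blast
  qed
  moreover have "finite ?I" using I(1) by simp
  ultimately show ?case using card by blast
qed

lemma cube_finite_cover:
  assumes "0 < \<delta>"
  obtains J :: "'a::euclidean_space set"
  where "finite J" "cube 0 1 \<subseteq> (\<Union>j\<in>J. ball j \<delta>)"
proof -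
  have "compact (cube (0::'a) 1)" by (simp add: cube_def)
  then show ?thesis using that assms by (auto simp: compact_eq_totally_bounded)
qed

text \<open>Comparison through the l1 norm. The factor d is crude, but it only affects the choice of
  scales.\<close>

lemma norm_le_cube:
  fixes z :: "'a::euclidean_space"
  assumes "z - y \<in> cube 0 r"
  shows "dist z y \<le> real DIM('a) * r"
proof -
  have "norm (z - y) \<le> (\<Sum>b\<in>Basis. \<bar>(z - y) \<bullet> b\<bar>)" by (rule norm_le_l1)
  also have "\<dots> \<le> (\<Sum>b\<in>(Basis::'a set). r)"
    using assms by (intro sum_mono) (auto simp: mem_cube)
  finally show ?thesis by (simp add: dist_norm)
qed

text \<open>A point \<open>v\<close> of the Voronoi cell outside the cube of radius \<open>R\<close> can be pulled along the segment to
  \<open>0\<close> onto the boundary of that cube; a point of \<open>\<xi>\<close> closer than \<open>R\<close> then contradicts membership.\<close>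

lemma Vor_subset_cube:
  fixes \<xi> :: "'a::euclidean_space set"
  assumes R: "0 < R" and \<delta>: "\<delta> * (real DIM('a) + 1) \<le> 1" "0 < \<delta>"
    and J: "cube 0 1 \<subseteq> (\<Union>j\<in>J. ball j \<delta>)"
    and good: "\<forall>j\<in>J. \<xi> \<inter> cube (R *\<^sub>R j) (R * \<delta>) \<noteq> {}"
  shows "Vor 0 \<xi> \<subseteq> cube 0 R"
proof (rule subsetI, rule ccontr)
  fix v assume v: "v \<in> Vor 0 \<xi>" and nv: "v \<notin> cube 0 R"
  define m where "m = Max ((\<lambda>b. \<bar>v \<bullet> b\<bar>) ` Basis)"
  have m_ge: "\<bar>v \<bullet> b\<bar> \<le> m" if "b \<in> Basis" for b
    unfolding m_def using that by (intro Max_ge) auto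
  have "m \<in> (\<lambda>b. \<bar>v \<bullet> b\<bar>) ` Basis" unfolding m_def by (intro Max_in) auto
  then obtain b0 where b0: "b0 \<in> Basis" "\<bar>v \<bullet> b0\<bar> = m" by auto
  have mR: "R < m"
  proof -
    obtain b where "b \<in> Basis" "R < \<bar>v \<bullet> b\<bar>" using nv by (auto simp: mem_cube not_le)
    then show ?thesis using m_ge[of b] by simp
  qed
  \<comment> \<open>The radial projection of \<open>v\<close> to the boundary of the unit cube; m is
    the maximum norm of \<open>v\<close>, so R u lies on the segment from 0 to
    \<open>v\<close>.\<close>
  define u where "u = (1 / m) *\<^sub>R v"
  have u_b0: "\<bar>u \<bullet> b0\<bar> = 1" using b0 mR R by (simp add: u_def abs_mult)
  have "u \<in> cube 0 1" using m_ge mR R by (auto simp: u_def mem_cube abs_mult field_simps)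
  then obtain j where j: "j \<in> J" "dist j u < \<delta>" using J by auto
  obtain z where z: "z \<in> \<xi>" "z \<in> cube (R *\<^sub>R j) (R * \<delta>)" using good j by blast
  have "dist z (R *\<^sub>R j) \<le> real DIM('a) * (R * \<delta>)"
    by (rule norm_le_cube) (use z in \<open>auto simp: mem_cube inner_diff_left\<close>)
  moreover have "dist (R *\<^sub>R j) (R *\<^sub>R u) < R * \<delta>"
    using j R by (simp add: dist_norm flip: scaleR_diff_right)
  \<comment> \<open>The summand d comes from the position of \<open>z\<close> in its grid cube, the
    summand 1 from the ball around \<open>j\<close> that contains \<open>u\<close>.\<close>
  ultimately have "dist z (R *\<^sub>R u) < R * (\<delta> * (real DIM('a) + 1))"
    using dist_triangle[of z "R *\<^sub>R u" "R *\<^sub>R j"] by (simp add: algebra_simps)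
  also have "\<dots> \<le> R" using R \<delta> by (simp add: mult_left_le)
  also have "R \<le> norm (R *\<^sub>R u)"
    using u_b0 b0 R Basis_le_norm[of b0 u] by simp
  finally have "norm (z - R *\<^sub>R u) < norm (R *\<^sub>R u)" by (simp add: dist_norm)
  then have "(norm (z - R *\<^sub>R u))\<^sup>2 < (norm (R *\<^sub>R u))\<^sup>2" by (intro power_strict_mono) auto
  \<comment> \<open>Being strictly closer to \<open>z\<close> than to 0 is a half-space condition on
    R u; the Voronoi property gives the opposite condition on \<open>v\<close>.\<close>
  then have 1: "z \<bullet> z < 2 * (z \<bullet> (R *\<^sub>R u))"
    unfolding power2_norm_eq_inner inner_diff_left inner_diff_right
    by (simp add: inner_commute)
  have "(norm v)\<^sup>2 \<le> (dist v z)\<^sup>2" using v z by (intro power_mono) (auto simp: Vor_def)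
  then have 2: "2 * (z \<bullet> v) \<le> z \<bullet> z"
    by (simp add: dist_norm power2_norm_eq_inner inner_diff_left inner_diff_right inner_commute)
  have Ru: "z \<bullet> (R *\<^sub>R u) = (R / m) * (z \<bullet> v)" by (simp add: u_def)
  have "z \<bullet> v > 0"
  proof (rule ccontr)
    assume "\<not> z \<bullet> v > 0"
    then have "(R / m) * (z \<bullet> v) \<le> 0" using R mR by (intro mult_nonneg_nonpos) auto
    then show False using 1 Ru inner_ge_zero[of z] by linarith
  qed
  \<comment> \<open>The inner product with \<open>z\<close> is positive and R / m < 1, so moving
    outwards from R u to \<open>v\<close> keeps the point on the side of \<open>z\<close>: a
    contradiction.\<close>
  then have "(R / m) * (z \<bullet> v) \<le> 1 * (z \<bullet> v)" using R mR by (intro mult_right_mono) auto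
  then show False using 1 2 Ru by linarith
qed

text \<open>A neighbour y shares a point v of its Voronoi cell with the cell of 0, and v is no
  farther from y than from 0, so |y| is at most twice |v|.\<close>

lemma dt_nbrs_subset_cube:
  fixes \<xi> :: "'a::euclidean_space set"
  assumes "Vor 0 \<xi> \<subseteq> cube 0 R"
  shows "dt_nbrs \<xi> 0 \<subseteq> \<xi> \<inter> cube 0 (2 * real DIM('a) * R)"
proof
  fix y assume "y \<in> dt_nbrs \<xi> 0"
  then have e: "dt_edge \<xi> 0 y" by (simp add: dt_nbrs_def)
  then have y: "y \<in> \<xi>" "0 \<in> \<xi>" by (auto simp: dt_edge_def)
  \<comment> \<open>The empty set has affine dimension -1, whereas the common face has dimension d -
    1, which is at least 0.\<close>
  have "aff_dim (Vor 0 \<xi> \<inter> Vor y \<xi>) \<noteq> aff_dim ({}::'a set)"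
    using e DIM_positive[where 'a='a] by (auto simp: dt_edge_def)
  then obtain v where v: "v \<in> Vor 0 \<xi>" "v \<in> Vor y \<xi>" by (metis disjoint_iff)
  have "v - 0 \<in> cube 0 R" using v assms by auto
  then have "dist v 0 \<le> real DIM('a) * R" by (rule norm_le_cube)
  moreover have "dist v y \<le> dist v 0" using v y by (auto simp: Vor_def)
  moreover have "dist 0 y \<le> dist v 0 + dist v y" by (rule dist_triangle3)
  ultimately have "norm y \<le> 2 * real DIM('a) * R" by simp
  then have "\<bar>y \<bullet> b\<bar> \<le> 2 * real DIM('a) * R" if "b \<in> Basis" for b
    using Basis_le_norm[OF that, of y] by linarith
  then show "y \<in> \<xi> \<inter> cube 0 (2 * real DIM('a) * R)" using y by (simp add: mem_cube)
qed

subsection \<open>Stationary point processes\<close>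

lemma space_Nspace: "space (Nspace :: 'a::euclidean_space set measure) = Collect locfin"
  unfolding Nspace_def by (rule space_measure_of) auto

lemma npts_bounded: "locfin \<xi> \<Longrightarrow> bounded A \<Longrightarrow> npts \<xi> A = of_nat (card (\<xi> \<inter> A))"
  by (simp add: npts_def locfin_finite)

lemma measurable_card_Nspace:
  fixes A :: "'a::euclidean_space set"
  assumes A: "A \<in> sets borel" "bounded A"
  shows "(\<lambda>\<xi>. card (\<xi> \<inter> A)) \<in> measurable Nspace (count_space UNIV)"
proof (subst measurable_count_space_eq2_countable, intro conjI ballI)
  fix k
  have "(\<lambda>\<xi>. card (\<xi> \<inter> A)) -` {k} \<inter> space Nspace = {\<xi> \<in> Collect locfin. npts \<xi> A = of_nat k}"
    using A by (auto simp: space_Nspace npts_bounded)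
  also have "\<dots> \<in> sets Nspace"
    unfolding Nspace_def
    by (subst sets_measure_of) (use A in \<open>auto intro!: sigma_sets.Basic\<close>)
  finally show "(\<lambda>\<xi>. card (\<xi> \<inter> A)) -` {k} \<inter> space Nspace \<in> sets Nspace" .
qed auto

text \<open>The full-measure set of (A3) is absorbed into an almost-sure statement. The quantifier
  over \<open>x\<close> stays inside it because \<open>x\<close> will run through the random points
  of the process.\<close>

locale stationary_point_process = prob_space M
  for M :: "'w measure" +
  fixes \<theta> :: "'a::euclidean_space \<Rightarrow> 'w \<Rightarrow> 'w" and pp :: "'w \<Rightarrow> 'a set"
  assumes theta_measurable: "\<theta> x \<in> measurable M M"
    and pp_measurable: "pp \<in> measurable M Nspace"
    and invariant: "distr M M (\<theta> x) = M"
    and nonempty: "AE \<omega> in M. pp \<omega> \<noteq> {}"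
    and covariant: "AE \<omega> in M. \<forall>x. pp (\<theta> x \<omega>) = (\<lambda>y. y - x) ` pp \<omega>"
begin

lemma locfin_pp: "\<omega> \<in> space M \<Longrightarrow> locfin (pp \<omega>)"
  using measurable_space[OF pp_measurable] by (simp add: space_Nspace)

lemma finite_pp: "\<omega> \<in> space M \<Longrightarrow> bounded A \<Longrightarrow> finite (pp \<omega> \<inter> A)"
  using locfin_pp by (rule locfin_finite)

definition cnt :: "'a \<Rightarrow> real \<Rightarrow> 'w \<Rightarrow> nat" where
  "cnt y r \<omega> = card (pp \<omega> \<inter> cube y r)"

definition void :: "'a \<Rightarrow> real \<Rightarrow> 'w set" where
  "void y r = {\<omega> \<in> space M. cnt y r \<omega> = 0}"

lemma measurable_card_pp:
  "A \<in> sets borel \<Longrightarrow> bounded A \<Longrightarrow> (\<lambda>\<omega>. card (pp \<omega> \<inter> A)) \<in> measurable M (count_space UNIV)"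
  by (rule measurable_compose[OF pp_measurable measurable_card_Nspace])

lemma cnt_measurable [measurable]: "cnt y r \<in> measurable M (count_space UNIV)"
  unfolding cnt_def by (rule measurable_card_pp) auto

lemma void_sets [measurable, simp]: "void y r \<in> sets M"
  unfolding void_def by measurable

lemma void_iff: "\<omega> \<in> void y r \<longleftrightarrow> \<omega> \<in> space M \<and> pp \<omega> \<inter> cube y r = {}"
  by (auto simp: void_def cnt_def card_eq_0_iff dest: finite_pp[OF _ bounded_cube, of \<omega> y r])

lemma void_mono: "cube y r \<subseteq> cube z s \<Longrightarrow> void z s \<subseteq> void y r"
  by (simp add: subset_iff void_iff) blast

lemma nn_integral_cnt_translate:
  fixes f :: "nat \<Rightarrow> ennreal"
  shows "(\<integral>\<^sup>+\<omega>. f (cnt y r \<omega>) \<partial>M) = (\<integral>\<^sup>+\<omega>. f (cnt z r \<omega>) \<partial>M)"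
proof -
  have [measurable]: "\<theta> x \<in> measurable M M" for x by (rule theta_measurable)
  have *: "(\<integral>\<^sup>+\<omega>. f (cnt 0 r \<omega>) \<partial>M) = (\<integral>\<^sup>+\<omega>. f (cnt x r \<omega>) \<partial>M)" for x
  proof -
    have "(\<integral>\<^sup>+\<omega>. f (cnt 0 r \<omega>) \<partial>M) = (\<integral>\<^sup>+\<omega>. f (cnt 0 r \<omega>) \<partial>distr M M (\<theta> x))"
      by (simp add: invariant)
    also have "\<dots> = (\<integral>\<^sup>+\<omega>. f (cnt 0 r (\<theta> x \<omega>)) \<partial>M)"
      by (subst nn_integral_distr) measurable
    also have "\<dots> = (\<integral>\<^sup>+\<omega>. f (cnt x r \<omega>) \<partial>M)"
      by (rule nn_integral_cong_AE)
        (use covariant in eventually_elim, simp add: cnt_def card_translate_cube)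
    finally show ?thesis .
  qed
  show ?thesis using *[of y] *[of z] by simp
qed

lemma prob_void_translate: "prob (void y r) = prob (void 0 r)"
proof -
  have "emeasure M (void y r) = (\<integral>\<^sup>+\<omega>. (if cnt y r \<omega> = 0 then 1 else 0) \<partial>M)" for y
  proof -
    have "emeasure M (void y r) = (\<integral>\<^sup>+\<omega>. indicator (void y r) \<omega> \<partial>M)" by simp
    also have "\<dots> = (\<integral>\<^sup>+\<omega>. (if cnt y r \<omega> = 0 then 1 else 0) \<partial>M)"
      by (intro nn_integral_cong) (auto simp: void_def indicator_def)
    finally show ?thesis .
  qed
  then have "emeasure M (void y r) = emeasure M (void 0 r)"
    using nn_integral_cnt_translate[of "\<lambda>n. if n = 0 then 1 else 0" y r 0] by simp
  then show ?thesis by (simp add: measure_def)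
qed

lemma rho_eq: "rho M pp q = (\<integral>\<^sup>+\<omega>. ennreal (real (cnt y (1/2) \<omega>) powr q) \<partial>M)"
proof -
  have "rho M pp q = (\<integral>\<^sup>+\<omega>. ennreal (real (cnt ((1/2) *\<^sub>R One) (1/2) \<omega>) powr q) \<partial>M)"
    unfolding rho_def unit_cube_eq_cube
    by (intro nn_integral_cong) (simp add: npts_bounded locfin_pp epow_of_nat cnt_def)
  also have "\<dots> = (\<integral>\<^sup>+\<omega>. ennreal (real (cnt y (1/2) \<omega>) powr q) \<partial>M)"
    by (rule nn_integral_cnt_translate)
  finally show ?thesis .
qed

lemma cond_C_iff:
  "cond_C M pp \<alpha> \<longleftrightarrow> (\<exists>\<kappa>>0. \<forall>l\<ge>1. prob (void 0 l) \<le> \<kappa> * l powr (- \<alpha>))"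
proof -
  have "{\<omega>\<in>space M. npts (pp \<omega>) (Lam l) = 0} = void 0 l" for l
    by (auto simp: void_def Lam_eq_cube npts_bounded locfin_pp cnt_def)
  then show ?thesis by (simp add: cond_C_def)
qed

text \<open>With N = 2^(dk) unit cubes covering the large cube, Jensen gives N^(p-1) times a sum of
  at most N mixed products. Each product splits into two moments of order p + 1, both at most
  \<open>\<kappa>\<close> on \<open>E\<close>, for a total of 2 N^p \<open>\<kappa>\<close>.\<close>

lemma nn_integral_cnt_mult_powr_le:
  assumes p: "1 \<le> p" and E: "E \<in> sets M"
    and \<kappa>: "\<And>y. (\<integral>\<^sup>+\<omega>. ennreal (real (cnt y (1/2) \<omega>) powr (p + 1)) * indicator E \<omega> \<partial>M) \<le> ennreal \<kappa>"
    and \<kappa>0: "0 \<le> \<kappa>"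
  shows "(\<integral>\<^sup>+\<omega>. of_nat (cnt u (1/2) \<omega>) * ennreal (real (cnt 0 (2 ^ k / 2) \<omega>) powr p) * indicator E \<omega> \<partial>M)
    \<le> ennreal (2 * (2 ^ (DIM('a) * k)) powr p * \<kappa>)"
proof -
  define N :: real where "N = 2 ^ (DIM('a) * k)"
  have N1: "1 \<le> N" by (simp add: N_def)
  obtain I :: "'a set" where I: "finite I" "card I \<le> 2 ^ (DIM('a) * k)"
    "cube 0 (2 ^ k / 2) \<subseteq> (\<Union>z\<in>I. cube z (1/2))"
    using cube_dyadic_cover[where y = "0::'a" and n = k] by blast
  have IN: "real (card I) \<le> N"
    unfolding N_def using of_nat_mono[OF I(2), where 'a = real] by simp
  let ?c = "\<lambda>z \<omega>. real (cnt z (1/2) \<omega>)"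
  have pw: "real (cnt u (1/2) \<omega>) * real (cnt 0 (2 ^ k / 2) \<omega>) powr p
     \<le> N powr (p - 1) * (\<Sum>z\<in>I. ?c u \<omega> powr (p + 1) + ?c z \<omega> powr (p + 1))"
    if \<omega>: "\<omega> \<in> space M" for \<omega>
  proof -
    have "cnt 0 (2 ^ k / 2) \<omega> \<le> card (\<Union>z\<in>I. pp \<omega> \<inter> cube z (1/2))"
      unfolding cnt_def using I by (intro card_mono finite_UN_I) (auto simp: finite_pp \<omega>)
    also have "\<dots> \<le> (\<Sum>z\<in>I. cnt z (1/2) \<omega>)"
      unfolding cnt_def by (rule card_UN_le) fact
    finally have "real (cnt 0 (2 ^ k / 2) \<omega>) \<le> (\<Sum>z\<in>I. ?c z \<omega>)"
      by (metis of_nat_le_iff of_nat_sum)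
    then have "real (cnt 0 (2 ^ k / 2) \<omega>) powr p \<le> (\<Sum>z\<in>I. ?c z \<omega>) powr p"
      using p by (intro powr_mono2) auto
    also have "\<dots> \<le> real (card I) powr (p - 1) * (\<Sum>z\<in>I. ?c z \<omega> powr p)"
      by (intro powr_sum_le I p) auto
    also have "\<dots> \<le> N powr (p - 1) * (\<Sum>z\<in>I. ?c z \<omega> powr p)"
      using IN p by (intro mult_right_mono powr_mono2 sum_nonneg) auto
    finally have "?c u \<omega> * real (cnt 0 (2 ^ k / 2) \<omega>) powr p
      \<le> ?c u \<omega> * (N powr (p - 1) * (\<Sum>z\<in>I. ?c z \<omega> powr p))"
      by (intro mult_left_mono) auto
    also have "\<dots> = N powr (p - 1) * (\<Sum>z\<in>I. ?c u \<omega> * ?c z \<omega> powr p)"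
      by (simp add: sum_distrib_left mult_ac)
    also have "\<dots> \<le> N powr (p - 1) * (\<Sum>z\<in>I. ?c u \<omega> powr (p + 1) + ?c z \<omega> powr (p + 1))"
      by (intro mult_left_mono sum_mono mult_powr_le p) auto
    finally show ?thesis .
  qed
  have "(\<integral>\<^sup>+\<omega>. of_nat (cnt u (1/2) \<omega>) * ennreal (real (cnt 0 (2 ^ k / 2) \<omega>) powr p) * indicator E \<omega> \<partial>M)
    \<le> (\<integral>\<^sup>+\<omega>. ennreal (N powr (p - 1)) * (\<Sum>z\<in>I. ennreal (?c u \<omega> powr (p + 1)) * indicator E \<omega> +
         ennreal (?c z \<omega> powr (p + 1)) * indicator E \<omega>) \<partial>M)"
  proof (rule nn_integral_mono)
    fix \<omega> assume \<omega>: "\<omega> \<in> space M"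
    have "of_nat (cnt u (1/2) \<omega>) * ennreal (real (cnt 0 (2 ^ k / 2) \<omega>) powr p) * indicator E \<omega>
      = ennreal (real (cnt u (1/2) \<omega>) * real (cnt 0 (2 ^ k / 2) \<omega>) powr p) * indicator E \<omega>"
      by (simp add: ennreal_mult ennreal_of_nat_eq_real_of_nat)
    also have "\<dots> \<le> ennreal (N powr (p - 1) * (\<Sum>z\<in>I. ?c u \<omega> powr (p + 1) + ?c z \<omega> powr (p + 1))) * indicator E \<omega>"
      by (intro mult_right_mono ennreal_leI pw \<omega>) auto
    also have "\<dots> = ennreal (N powr (p - 1)) * (\<Sum>z\<in>I. ennreal (?c u \<omega> powr (p + 1)) * indicator E \<omega> +
         ennreal (?c z \<omega> powr (p + 1)) * indicator E \<omega>)"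
      by (simp add: ennreal_mult sum_nonneg sum_distrib_right distrib_right mult.assoc flip: sum_ennreal)
    finally show "of_nat (cnt u (1/2) \<omega>) * ennreal (real (cnt 0 (2 ^ k / 2) \<omega>) powr p) * indicator E \<omega> \<le> \<dots>" .
  qed
  also have "\<dots> = ennreal (N powr (p - 1)) *
      (\<Sum>z\<in>I. (\<integral>\<^sup>+\<omega>. ennreal (?c u \<omega> powr (p + 1)) * indicator E \<omega> \<partial>M) +
         (\<integral>\<^sup>+\<omega>. ennreal (?c z \<omega> powr (p + 1)) * indicator E \<omega> \<partial>M))"
    using E by (subst nn_integral_cmult, measurable) (simp add: nn_integral_sum nn_integral_add)
  also have "\<dots> \<le> ennreal (N powr (p - 1)) * (\<Sum>z\<in>I. ennreal \<kappa> + ennreal \<kappa>)"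
    by (intro mult_left_mono sum_mono add_mono \<kappa>) auto
  also have "\<dots> = ennreal (N powr (p - 1) * (real (card I) * (2 * \<kappa>)))"
    using \<kappa>0 by (simp add: ennreal_mult ennreal_of_nat_eq_real_of_nat flip: ennreal_plus)
  also have "\<dots> \<le> ennreal (N powr (p - 1) * (N * (2 * \<kappa>)))"
    using IN \<kappa>0 by (intro ennreal_leI mult_left_mono mult_right_mono) auto
  also have "N powr (p - 1) * (N * (2 * \<kappa>)) = 2 * N powr p * \<kappa>"
    using N1 by (simp add: powr_diff)
  finally show ?thesis by (simp add: N_def)
qed

section \<open>Decay of moments on void events\<close>

definition void_moment_decay :: "real \<Rightarrow> bool" where
  "void_moment_decay p \<longleftrightarrow> (\<exists>\<beta>>real DIM('a) * p. \<exists>K\<ge>0. \<exists>l0\<ge>1. \<forall>y z. \<forall>l\<ge>l0.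
     (\<integral>\<^sup>+\<omega>. ennreal (real (cnt y (1/2) \<omega>) powr (p + 1)) * indicator (void z l) \<omega> \<partial>M)
       \<le> ennreal (K * l powr (- \<beta>)))"

text \<open>Truncate the count at a level T: the part below T is controlled by the void probability,
  the part above T by the moment of order \<open>\<gamma>\<close>. The hypothesis on
  \<open>\<alpha>\<close> says exactly that the resulting exponent \<open>\<beta>\<close> exceeds d
  p.\<close>

lemma void_moment_decay_moments:
  assumes p: "1 \<le> p" and \<gamma>: "p + 1 < \<gamma>" and rho: "rho M pp \<gamma> < \<infinity>"
    and \<alpha>: "real DIM('a) * p * \<gamma> / (\<gamma> - 1 - p) < \<alpha>" and C: "cond_C M pp \<alpha>"
  shows "void_moment_decay p"
proof -
  obtain \<kappa> where \<kappa>: "\<kappa> > 0" "\<And>l. 1 \<le> l \<Longrightarrow> prob (void 0 l) \<le> \<kappa> * l powr (- \<alpha>)"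
    using C by (auto simp: cond_C_iff)
  obtain \<rho> where \<rho>: "rho M pp \<gamma> = ennreal \<rho>" "0 \<le> \<rho>" using rho by (cases "rho M pp \<gamma>") auto
  define \<beta> where "\<beta> = \<alpha> * (\<gamma> - 1 - p) / \<gamma>"
  have \<beta>: "\<beta> > real DIM('a) * p"
    using \<alpha> \<gamma> p by (simp add: \<beta>_def pos_divide_less_eq pos_less_divide_eq)
  have main: "(\<integral>\<^sup>+\<omega>. ennreal (real (cnt y (1/2) \<omega>) powr (p + 1)) * indicator (void z l) \<omega> \<partial>M)
       \<le> ennreal ((\<kappa> + \<rho>) * l powr (- \<beta>))" if l: "1 \<le> l" for y z l
  proof -
    \<comment> \<open>This level balances the two parts: both T^(p+1) l^(-\<open>\<alpha>\<close>)
      and T^(p+1-\<open>\<gamma>\<close>) become l^(-\<open>\<beta>\<close>).\<close>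
    define T where "T = l powr (\<alpha> / \<gamma>)"
    have T: "T > 0" using l by (simp add: T_def)
    have T1: "T powr (p + 1) * l powr (- \<alpha>) = l powr (- \<beta>)"
    proof -
      have "T powr (p + 1) * l powr (- \<alpha>) = l powr (\<alpha> / \<gamma> * (p + 1) + - \<alpha>)"
        unfolding T_def powr_powr by (rule powr_add[symmetric])
      also have "\<alpha> / \<gamma> * (p + 1) + - \<alpha> = - \<beta>"
        using \<gamma> p by (simp add: \<beta>_def diff_divide_distrib distrib_left right_diff_distrib add_divide_distrib)
      finally show ?thesis .
    qed
    have T2: "T powr (p + 1 - \<gamma>) = l powr (- \<beta>)"
    proof -
      have "\<alpha> / \<gamma> * (p + 1 - \<gamma>) = - \<beta>"
        using \<gamma> p by (simp add: \<beta>_def diff_divide_distrib distrib_left right_diff_distrib add_divide_distrib)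
      then show ?thesis unfolding T_def powr_powr by (rule arg_cong)
    qed
    have trunc: "x powr (p + 1) \<le> T powr (p + 1) + x powr \<gamma> * T powr (p + 1 - \<gamma>)"
      if x: "0 \<le> x" for x
    proof (cases "x \<le> T")
      case True
      then have "x powr (p + 1) \<le> T powr (p + 1)" using p x by (intro powr_mono2) auto
      then show ?thesis by (simp add: add_increasing2)
    next
      case False
      \<comment> \<open>The exponent p + 1 - \<open>\<gamma>\<close> is negative, so replacing x by
        the smaller T increases that factor.\<close>
      have "x powr (p + 1) = x powr \<gamma> * x powr (p + 1 - \<gamma>)"
        unfolding powr_add[symmetric] by simp
      also have "\<dots> \<le> x powr \<gamma> * T powr (p + 1 - \<gamma>)"
        using False T \<gamma> by (intro mult_left_mono powr_mono2') auto
      finally show ?thesis by (simp add: add_increasing)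
    qed
    have "(\<integral>\<^sup>+\<omega>. ennreal (real (cnt y (1/2) \<omega>) powr (p + 1)) * indicator (void z l) \<omega> \<partial>M)
      \<le> (\<integral>\<^sup>+\<omega>. ennreal (T powr (p + 1)) * indicator (void z l) \<omega> +
             ennreal (T powr (p + 1 - \<gamma>)) * ennreal (real (cnt y (1/2) \<omega>) powr \<gamma>) \<partial>M)"
    proof (rule nn_integral_mono)
      fix \<omega>
      have "ennreal (real (cnt y (1/2) \<omega>) powr (p + 1)) \<le> ennreal (T powr (p + 1)) +
             ennreal (T powr (p + 1 - \<gamma>)) * ennreal (real (cnt y (1/2) \<omega>) powr \<gamma>)"
      proof -
        have "ennreal (real (cnt y (1/2) \<omega>) powr (p + 1))
          \<le> ennreal (T powr (p + 1) + T powr (p + 1 - \<gamma>) * real (cnt y (1/2) \<omega>) powr \<gamma>)"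
          using trunc[of "real (cnt y (1/2) \<omega>)"] by (intro ennreal_leI) (simp add: mult.commute)
        also have "\<dots> = ennreal (T powr (p + 1)) + ennreal (T powr (p + 1 - \<gamma>)) * ennreal (real (cnt y (1/2) \<omega>) powr \<gamma>)"
          by (subst ennreal_plus) (auto simp: ennreal_mult)
        finally show ?thesis .
      qed
      then show "ennreal (real (cnt y (1/2) \<omega>) powr (p + 1)) * indicator (void z l) \<omega> \<le>
         ennreal (T powr (p + 1)) * indicator (void z l) \<omega> +
             ennreal (T powr (p + 1 - \<gamma>)) * ennreal (real (cnt y (1/2) \<omega>) powr \<gamma>)"
        by (simp add: indicator_def)
    qed
    also have "\<dots> = ennreal (T powr (p + 1)) * emeasure M (void z l) +
        ennreal (T powr (p + 1 - \<gamma>)) * rho M pp \<gamma>"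
      unfolding rho_eq[of \<gamma> y] by (subst nn_integral_add, measurable) (simp add: nn_integral_cmult)
    also have "\<dots> = ennreal (T powr (p + 1) * prob (void 0 l) + T powr (p + 1 - \<gamma>) * \<rho>)"
      using \<rho> by (simp add: emeasure_eq_measure prob_void_translate[of z] ennreal_mult)
    also have "\<dots> \<le> ennreal (T powr (p + 1) * (\<kappa> * l powr (- \<alpha>)) + T powr (p + 1 - \<gamma>) * \<rho>)"
      using l by (intro ennreal_leI add_right_mono mult_left_mono \<kappa>) auto
    also have "T powr (p + 1) * (\<kappa> * l powr (- \<alpha>)) + T powr (p + 1 - \<gamma>) * \<rho> = (\<kappa> + \<rho>) * l powr (- \<beta>)"
      unfolding T2 distrib_right T1[symmetric] by (simp only: mult_ac)
    finally show ?thesis .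
  qed
  show ?thesis
    unfolding void_moment_decay_def
    by (rule exI[of _ \<beta>], intro conjI \<beta>, rule exI[of _ "\<kappa> + \<rho>"], intro conjI, use \<kappa> \<rho> in simp,
        rule exI[of _ 1]) (use main in auto)
qed

text \<open>The cube \<open>cube z l\<close> contains a cube a quarter of its size that is far from \<open>y\<close>.\<close>

lemma void_moment_decay_decoupled:
  assumes p: "1 \<le> p" and rho: "rho M pp (1 + p) < \<infinity>" and L: "0 \<le> L"
    and dec: "\<And>y z l b. 0 < l \<Longrightarrow> b \<in> Basis \<Longrightarrow> l + 1/2 + L \<le> \<bar>y \<bullet> b - z \<bullet> b\<bar> \<Longrightarrow>
      (\<integral>\<^sup>+\<omega>. ennreal (real (cnt y (1/2) \<omega>) powr (p + 1)) * indicator (void z l) \<omega> \<partial>M)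
        \<le> rho M pp (1 + p) * prob (void z l)"
    and \<alpha>: "real DIM('a) * p < \<alpha>" and C: "cond_C M pp \<alpha>"
  shows "void_moment_decay p"
proof -
  obtain \<kappa> where \<kappa>: "\<kappa> > 0" "\<And>l. 1 \<le> l \<Longrightarrow> prob (void 0 l) \<le> \<kappa> * l powr (- \<alpha>)"
    using C by (auto simp: cond_C_iff)
  obtain \<rho> where \<rho>: "rho M pp (1 + p) = ennreal \<rho>" "0 \<le> \<rho>" using rho by (cases "rho M pp (1 + p)") auto
  have main: "(\<integral>\<^sup>+\<omega>. ennreal (real (cnt y (1/2) \<omega>) powr (p + 1)) * indicator (void z l) \<omega> \<partial>M)
       \<le> ennreal ((\<rho> * \<kappa> * 4 powr \<alpha>) * l powr (- \<alpha>))" if l: "4 + 2 * L \<le> l" for y z l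
  proof -
    obtain b :: 'a where b: "b \<in> Basis" using nonempty_Basis by blast
    \<comment> \<open>Shift the centre by 3l/4 away from \<open>y\<close> along one axis. The
      subcube of radius l/4 stays inside \<open>cube z l\<close>, and its centre is at least 3l/4
      from \<open>y\<close> in that coordinate. The condition l >= 4 + 2L leaves the gap
      \<open>L\<close> beyond both radii and also makes l/4 at least 1, as Condition C
      requires.\<close>
    define s :: real where "s = (if z \<bullet> b \<ge> y \<bullet> b then 3 / 4 * l else - (3 / 4 * l))"
    define z' where "z' = z + s *\<^sub>R b"
    have z': "z' \<bullet> i = (if i = b then z \<bullet> b + s else z \<bullet> i)" if "i \<in> Basis" for i
      using that b by (auto simp: z'_def inner_add_left inner_Basis)
    have s: "\<bar>s\<bar> = 3 / 4 * l" using l L by (simp add: s_def)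
    have "cube z' (l / 4) \<subseteq> cube z l"
      unfolding subset_iff mem_cube
    proof (intro allI impI ballI)
      fix w i assume w: "\<forall>i\<in>Basis. \<bar>w \<bullet> i - z' \<bullet> i\<bar> \<le> l / 4" and i: "i \<in> (Basis::'a set)"
      show "\<bar>w \<bullet> i - z \<bullet> i\<bar> \<le> l"
      proof (cases "i = b")
        case True
        then have "\<bar>w \<bullet> i - (z \<bullet> i + s)\<bar> \<le> l / 4" using bspec[OF w i] z'[OF i] by simp
        then show ?thesis using s l L by linarith
      next
        case False
        then have "\<bar>w \<bullet> i - z \<bullet> i\<bar> \<le> l / 4" using bspec[OF w i] z'[OF i] by simp
        then show ?thesis using l L by linarith
      qed
    qed
    then have sub: "void z l \<subseteq> void z' (l / 4)" by (rule void_mono)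
    have "(\<integral>\<^sup>+\<omega>. ennreal (real (cnt y (1/2) \<omega>) powr (p + 1)) * indicator (void z l) \<omega> \<partial>M)
      \<le> (\<integral>\<^sup>+\<omega>. ennreal (real (cnt y (1/2) \<omega>) powr (p + 1)) * indicator (void z' (l / 4)) \<omega> \<partial>M)"
      using sub by (intro nn_integral_mono mult_left_mono) (auto simp: indicator_def)
    also have "\<dots> \<le> rho M pp (1 + p) * prob (void z' (l / 4))"
      by (rule dec[OF _ b]) (use l L b in \<open>auto simp: z' s_def\<close>)
    also have "\<dots> = ennreal (\<rho> * prob (void 0 (l / 4)))"
      using \<rho> by (simp add: prob_void_translate[of z'] ennreal_mult)
    also have "\<dots> \<le> ennreal (\<rho> * (\<kappa> * (l / 4) powr (- \<alpha>)))"
      using l L \<rho> by (intro ennreal_leI mult_left_mono \<kappa>) auto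
    also have "(l / 4) powr (- \<alpha>) = 4 powr \<alpha> * l powr (- \<alpha>)"
      using l L by (simp add: powr_divide powr_minus field_simps)
    finally show ?thesis by (simp add: mult_ac)
  qed
  show ?thesis
    unfolding void_moment_decay_def
    by (rule exI[of _ \<alpha>], intro conjI \<alpha>, rule exI[of _ "\<rho> * \<kappa> * 4 powr \<alpha>"], intro conjI, use \<kappa> \<rho> in simp,
        rule exI[of _ "4 + 2 * L"]) (use main L in auto)
qed

end

subsection \<open>Finite range of dependence and positive association\<close>

text \<open>From ln s <= s - 1 with s = xc/a: multiplying by a and exponentiating bounds (xc/a)^a by
  exp(cx), and inverting gives the claim. It converts exponential decay into any power
  decay.\<close>

lemma powr_mult_exp_le:
  fixes a c x :: real
  assumes "0 < a" "0 < c" "0 < x"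
  shows "exp (- (c * x)) \<le> (a / c) powr a * x powr (- a)"
proof -
  have "ln (x * c / a) \<le> x * c / a"
    using ln_le_minus_one[of "x * c / a"] assms by simp
  then have "a * ln (x * c / a) \<le> c * x"
    using assms by (simp add: pos_le_divide_eq mult.commute)
  then have "exp (a * ln (x * c / a)) \<le> exp (c * x)" by simp
  moreover have "exp (a * ln (x * c / a)) = (x * c / a) powr a"
    using assms by (simp add: powr_def)
  ultimately have le: "(x * c / a) powr a \<le> exp (c * x)" by simp
  have "(x * c / a) powr a * ((a / c) powr a * x powr (- a)) = 1"
    using assms by (simp add: powr_mult powr_divide powr_minus)
  then have "(a / c) powr a * x powr (- a) = inverse ((x * c / a) powr a)"
    by (rule inverse_unique[symmetric])
  moreover have "inverse (exp (c * x)) \<le> inverse ((x * c / a) powr a)"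
    using le assms by (intro le_imp_inverse_le) auto
  ultimately show ?thesis by (simp add: exp_minus)
qed

context stationary_point_process
begin

lemma finite_range_nn_integral_mult:
  fixes f g :: "nat \<Rightarrow> ennreal"
  assumes ind: "indep_var Nspace (\<lambda>\<omega>. pp \<omega> \<inter> A) Nspace (\<lambda>\<omega>. pp \<omega> \<inter> B)"
    and A: "A \<in> sets borel" "bounded A" and B: "B \<in> sets borel" "bounded B"
  shows "(\<integral>\<^sup>+\<omega>. f (card (pp \<omega> \<inter> A)) * g (card (pp \<omega> \<inter> B)) \<partial>M)
    = (\<integral>\<^sup>+\<omega>. f (card (pp \<omega> \<inter> A)) \<partial>M) * (\<integral>\<^sup>+\<omega>. g (card (pp \<omega> \<inter> B)) \<partial>M)"
proof -
  let ?F = "\<lambda>\<omega>. f (card (pp \<omega> \<inter> A))" and ?G = "\<lambda>\<omega>. g (card (pp \<omega> \<inter> B))"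
  have "(\<lambda>\<xi>. f (card (\<xi> \<inter> A))) \<in> measurable Nspace borel" "(\<lambda>\<xi>. g (card (\<xi> \<inter> B))) \<in> measurable Nspace borel"
    by (auto intro!: measurable_compose[OF measurable_card_Nspace] A B)
  \<comment> \<open>The counts are functions of the restricted configurations; intersecting with
    \<open>A\<close> or \<open>B\<close> a second time changes nothing.\<close>
  from indep_var_compose[OF ind this] have "indep_var borel ?F borel ?G"
    by (simp add: comp_def Int_assoc)
  moreover have "(\<lambda>_. borel) = case_bool borel (borel :: ennreal measure)"
    by (auto split: bool.split)
  ultimately have "indep_vars (\<lambda>_. borel) (case_bool ?F ?G) UNIV"
    by (simp add: indep_var_def)
  from indep_vars_nn_integral[OF _ this] show ?thesis
    by (simp add: UNIV_bool mult.commute)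
qed

text \<open>Continuity from above: a configuration missing every centred cube is empty, which has
  probability zero.\<close>

lemma ex_prob_void_le_half: "\<exists>a\<ge>1. prob (void 0 a) \<le> 1 / 2"
proof -
  have "(\<lambda>n. prob (void 0 (real n))) \<longlonglongrightarrow> prob (\<Inter>n. void 0 (real n))"
    by (intro finite_Lim_measure_decseq)
      (auto simp: antimono_def intro!: void_mono cube_mono)
  moreover have "(\<Inter>n. void 0 (real n)) \<subseteq> {\<omega>\<in>space M. pp \<omega> = {}}"
  proof (intro subsetI CollectI conjI)
    fix \<omega> assume \<omega>: "\<omega> \<in> (\<Inter>n. void 0 (real n))"
    then show "\<omega> \<in> space M" by (auto simp: void_def)
    show "pp \<omega> = {}"
    proof (rule equals0I)
      fix x assume x: "x \<in> pp \<omega>"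
      obtain n where "norm x \<le> real n" using real_arch_simple by blast
      then have "x \<in> cube 0 (real n)"
        unfolding mem_cube using Basis_le_norm[of _ x] by (auto intro: order_trans)
      moreover have "\<omega> \<in> void 0 (real n)" using \<omega> by blast
      ultimately show False using x by (auto simp: void_iff)
    qed
  qed
  then have "AE \<omega> in M. \<omega> \<notin> (\<Inter>n. void 0 (real n))"
    using nonempty by (auto elim!: eventually_mono)
  then have "prob (\<Inter>n. void 0 (real n)) = 0"
    by (intro measure_eq_0_null_sets) (auto simp: AE_iff_null_sets)
  ultimately have "(\<lambda>n. prob (void 0 (real n))) \<longlonglongrightarrow> 0" by simp
  then have "eventually (\<lambda>n. prob (void 0 (real n)) < 1 / 2) sequentially"
    by (rule order_tendstoD) simp
  moreover have "eventually (\<lambda>n. 1 \<le> n) sequentially" by (rule eventually_ge_at_top)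
  ultimately have "eventually (\<lambda>n. 1 \<le> n \<and> prob (void 0 (real n)) < 1 / 2) sequentially"
    by eventually_elim simp
  then obtain n where "1 \<le> n" "prob (void 0 (real n)) < 1 / 2"
    by (auto dest: eventually_happens)
  then show ?thesis by (intro exI[of _ "real n"]) auto
qed

text \<open>A cube of side 2l contains a number of order l of translates of one fixed cube, pairwise
  at distance at least \<open>L\<close>. Each is empty with probability at most 1/2, independently,
  so void probabilities decay exponentially.\<close>

lemma cond_C_finite_range:
  assumes fr: "finite_range_dep M pp" and \<alpha>: "0 < \<alpha>"
  shows "cond_C M pp \<alpha>"
proof -
  obtain L where L: "L > 0" and ind: "\<And>A B. A \<in> sets borel \<Longrightarrow> B \<in> sets borel \<Longrightarrow>
     (\<forall>a\<in>A. \<forall>b\<in>B. L \<le> dist a b) \<Longrightarrow> indep_var Nspace (\<lambda>\<omega>. pp \<omega> \<inter> A) Nspace (\<lambda>\<omega>. pp \<omega> \<inter> B)"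
    using fr unfolding finite_range_dep_def by blast
  obtain a where a: "1 \<le> a" "prob (void 0 a) \<le> 1 / 2" using ex_prob_void_le_half by blast
  obtain e :: 'a where e: "e \<in> Basis" using nonempty_Basis by blast
  \<comment> \<open>With this spacing, consecutive cubes of radius \<open>a\<close> on the axis
    \<open>e\<close> have a gap of exactly \<open>L\<close>.\<close>
  define D where "D = 2 * a + L"
  have D: "D > 0" using a L by (simp add: D_def)
  define Q where "Q i = cube ((real i * D) *\<^sub>R e) a" for i :: nat
  define V where "V A = (\<integral>\<^sup>+\<omega>. (if card (pp \<omega> \<inter> A) = 0 then 1 else 0) \<partial>M)" for A
  have VQ: "V (cube y r) = emeasure M (void y r)" for y r
  proof -
    have "emeasure M (void y r) = (\<integral>\<^sup>+\<omega>. indicator (void y r) \<omega> \<partial>M)" by simp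
    also have "\<dots> = V (cube y r)"
      unfolding V_def by (intro nn_integral_cong) (auto simp: void_def indicator_def cnt_def)
    finally show ?thesis by simp
  qed
  have Vk: "V (\<Union>i<k. Q i) \<le> ennreal ((1 / 2) ^ k)" for k
  proof (induction k)
    case 0
    then show ?case by (simp add: V_def emeasure_space_1)
  next
    case (Suc k)
    let ?A = "\<Union>i<k. Q i"
    have A: "?A \<in> sets borel" "bounded ?A" "Q k \<in> sets borel" "bounded (Q k)"
      by (auto simp: Q_def intro!: bounded_UN)
    have far: "\<forall>x\<in>?A. \<forall>y\<in>Q k. L \<le> dist x y"
    proof (intro ballI)
      fix x y assume "x \<in> ?A" and y: "y \<in> Q k"
      then obtain i where i: "i < k" "x \<in> Q i" by auto
      have x': "\<bar>x \<bullet> e - real i * D\<bar> \<le> a" and y': "\<bar>y \<bullet> e - real k * D\<bar> \<le> a"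
        using i y e by (auto simp: Q_def mem_cube)
      have "(real i + 1) * D \<le> real k * D" using i D by (intro mult_right_mono) auto
      then have "L \<le> \<bar>(x - y) \<bullet> e\<bar>"
        using x' y' by (simp add: inner_diff_left D_def algebra_simps)
      also have "\<dots> \<le> dist x y" using Basis_le_norm[OF e] by (simp add: dist_norm)
      finally show "L \<le> dist x y" .
    qed
    have "V (\<Union>i<Suc k. Q i) = (\<integral>\<^sup>+\<omega>. (if card (pp \<omega> \<inter> ?A) = 0 then 1 else 0) *
        (if card (pp \<omega> \<inter> Q k) = 0 then 1 else 0) \<partial>M)"
      unfolding V_def
    proof (rule nn_integral_cong)
      fix \<omega> assume \<omega>: "\<omega> \<in> space M"
      have "finite (pp \<omega> \<inter> ?A)" "finite (pp \<omega> \<inter> Q k)" using A \<omega> by (auto intro: finite_pp)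
      moreover have "pp \<omega> \<inter> (\<Union>i<Suc k. Q i) = (pp \<omega> \<inter> ?A) \<union> (pp \<omega> \<inter> Q k)"
        by (auto simp: lessThan_Suc)
      ultimately show "(if card (pp \<omega> \<inter> (\<Union>i<Suc k. Q i)) = 0 then 1 else 0) =
        (if card (pp \<omega> \<inter> ?A) = 0 then 1 else 0) * (if card (pp \<omega> \<inter> Q k) = 0 then 1 else (0::ennreal))"
        by (simp add: card_eq_0_iff)
    qed
    also have "\<dots> = V ?A * V (Q k)"
      unfolding V_def by (rule finite_range_nn_integral_mult[OF ind[OF A(1,3) far] A])
    also have "V (Q k) = ennreal (prob (void 0 a))"
      by (simp add: Q_def VQ emeasure_eq_measure prob_void_translate[of "(real k * D) *\<^sub>R e"])
    also have "V ?A * ennreal (prob (void 0 a)) \<le> ennreal ((1 / 2) ^ k) * ennreal (1 / 2)"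
      using a by (intro mult_mono Suc ennreal_leI) auto
    also have "\<dots> = ennreal ((1 / 2) ^ Suc k)"
      by (subst ennreal_mult[symmetric]) (auto simp: mult.commute)
    finally show ?case .
  qed
  \<comment> \<open>About l / D cubes fit, which gives 2^(-l/D) = exp(-c l) up to the factor 2 lost
    by rounding down.\<close>
  define c where "c = ln 2 / D"
  have c: "c > 0" using D by (simp add: c_def)
  have "prob (void 0 l) \<le> (2 * (\<alpha> / c) powr \<alpha>) * l powr (- \<alpha>)" if l: "1 \<le> l" for l
  proof -
    define k where "k = nat \<lfloor>l / D\<rfloor>"
    have k: "real k \<le> l / D" "l / D < real k + 1"
      using l D by (auto simp: k_def of_nat_nat)
    have kD: "real k * D \<le> l" using k D by (simp add: pos_le_divide_eq)
    \<comment> \<open>Cube number i reaches at most i D + a <= (i + 1) D <= k D <= l along the axis;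
      in the other coordinates it is centred with radius a <= D.\<close>
    have sub: "(\<Union>i<k. Q i) \<subseteq> cube 0 l"
    proof
      fix x assume "x \<in> (\<Union>i<k. Q i)"
      then obtain i where i: "i < k" "x \<in> Q i" by auto
      have iD: "(real i + 1) * D \<le> real k * D" using i D by (intro mult_right_mono) auto
      have i0: "0 \<le> real i * D" using D by simp
      show "x \<in> cube 0 l"
        unfolding mem_cube
      proof
        fix b :: 'a assume b: "b \<in> Basis"
        define s where "s = (if b = e then real i * D else 0)"
        have "\<bar>x \<bullet> b - s\<bar> \<le> a"
          using i b e by (auto simp: Q_def mem_cube inner_Basis s_def)
        moreover have "0 \<le> s" "s \<le> real i * D" using i0 by (auto simp: s_def)
        moreover have "a \<le> D" using a L by (simp add: D_def)
        ultimately have "\<bar>x \<bullet> b\<bar> \<le> real i * D + D" by linarith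
        then show "\<bar>x \<bullet> b - 0 \<bullet> b\<bar> \<le> l" using iD kD by (simp add: algebra_simps)
      qed
    qed
    have "ennreal (prob (void 0 l)) = V (cube 0 l)" by (simp add: VQ emeasure_eq_measure)
    also have "\<dots> \<le> V (\<Union>i<k. Q i)"
      unfolding V_def
    proof (rule nn_integral_mono)
      fix \<omega> assume \<omega>: "\<omega> \<in> space M"
      have "card (pp \<omega> \<inter> (\<Union>i<k. Q i)) \<le> card (pp \<omega> \<inter> cube 0 l)"
        using sub \<omega> by (intro card_mono finite_pp) auto
      then show "(if card (pp \<omega> \<inter> cube 0 l) = 0 then 1 else 0) \<le>
          (if card (pp \<omega> \<inter> (\<Union>i<k. Q i)) = 0 then 1 else (0::ennreal))" by auto
    qed
    also have "\<dots> \<le> ennreal ((1 / 2) ^ k)" by (rule Vk)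
    finally have "prob (void 0 l) \<le> (1 / 2) ^ k" by simp
    also have "(1 / 2) ^ k = exp (- (ln 2 * real k))"
      by (simp add: exp_minus exp_of_nat2_mult power_one_over inverse_eq_divide)
    also have "\<dots> \<le> exp (ln 2 + - (c * l))"
    proof -
      have "ln 2 * (l / D) \<le> ln 2 * (real k + 1)" using k by (intro mult_left_mono) auto
      then show ?thesis by (simp add: c_def algebra_simps)
    qed
    also have "\<dots> = 2 * exp (- (c * l))" unfolding exp_add by simp
    also have "\<dots> \<le> 2 * ((\<alpha> / c) powr \<alpha> * l powr (- \<alpha>))"
      using l c \<alpha> by (intro mult_left_mono powr_mult_exp_le) auto
    finally show ?thesis by simp
  qed
  moreover have "2 * (\<alpha> / c) powr \<alpha> > 0" using \<alpha> c by simp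
  ultimately show ?thesis unfolding cond_C_iff by blast
qed

lemma void_moment_decay_finite_range:
  assumes p: "1 \<le> p" and rho: "rho M pp (1 + p) < \<infinity>" and fr: "finite_range_dep M pp"
  shows "void_moment_decay p"
proof -
  obtain L where L: "L > 0" and ind: "\<And>A B. A \<in> sets borel \<Longrightarrow> B \<in> sets borel \<Longrightarrow>
     (\<forall>a\<in>A. \<forall>b\<in>B. L \<le> dist a b) \<Longrightarrow> indep_var Nspace (\<lambda>\<omega>. pp \<omega> \<inter> A) Nspace (\<lambda>\<omega>. pp \<omega> \<inter> B)"
    using fr unfolding finite_range_dep_def by blast
  show ?thesis
  \<comment> \<open>Void probabilities decay faster than every power, so d p + 1 serves as an
    exponent above d p.\<close>
  proof (rule void_moment_decay_decoupled[OF p rho, of L "real DIM('a) * p + 1"])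
    fix y z :: 'a and l b assume l: "0 < l" and b: "b \<in> Basis" and far: "l + 1 / 2 + L \<le> \<bar>y \<bullet> b - z \<bullet> b\<bar>"
    have "\<forall>u\<in>cube y (1/2). \<forall>v\<in>cube z l. L \<le> dist u v"
    proof (intro ballI)
      fix u v assume "u \<in> cube y (1/2)" "v \<in> cube z l"
      then have "\<bar>u \<bullet> b - y \<bullet> b\<bar> \<le> 1 / 2" "\<bar>v \<bullet> b - z \<bullet> b\<bar> \<le> l" using b by (auto simp: mem_cube)
      then have "L \<le> \<bar>(u - v) \<bullet> b\<bar>" using far unfolding inner_diff_left by linarith
      also have "\<dots> \<le> dist u v" using Basis_le_norm[OF b] by (simp add: dist_norm)
      finally show "L \<le> dist u v" .
    qed
    then have i: "indep_var Nspace (\<lambda>\<omega>. pp \<omega> \<inter> cube y (1/2)) Nspace (\<lambda>\<omega>. pp \<omega> \<inter> cube z l)"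
      by (intro ind) auto
    have "(\<integral>\<^sup>+\<omega>. ennreal (real (cnt y (1/2) \<omega>) powr (p + 1)) * indicator (void z l) \<omega> \<partial>M)
      = (\<integral>\<^sup>+\<omega>. ennreal (real (card (pp \<omega> \<inter> cube y (1/2))) powr (p + 1)) * (if card (pp \<omega> \<inter> cube z l) = 0 then 1 else 0) \<partial>M)"
      by (intro nn_integral_cong) (auto simp: void_def indicator_def cnt_def)
    also have "\<dots> = (\<integral>\<^sup>+\<omega>. ennreal (real (card (pp \<omega> \<inter> cube y (1/2))) powr (p + 1)) \<partial>M) *
        (\<integral>\<^sup>+\<omega>. (if card (pp \<omega> \<inter> cube z l) = 0 then 1 else 0) \<partial>M)"
      by (rule finite_range_nn_integral_mult[OF i]) auto
    also have "(\<integral>\<^sup>+\<omega>. (if card (pp \<omega> \<inter> cube z l) = 0 then 1 else 0) \<partial>M) = (\<integral>\<^sup>+\<omega>. indicator (void z l) \<omega> \<partial>M)"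
      by (intro nn_integral_cong) (auto simp: void_def indicator_def cnt_def)
    finally show "(\<integral>\<^sup>+\<omega>. ennreal (real (cnt y (1/2) \<omega>) powr (p + 1)) * indicator (void z l) \<omega> \<partial>M)
        \<le> rho M pp (1 + p) * prob (void z l)"
      by (simp add: rho_eq[of _ y] cnt_def emeasure_eq_measure add.commute)
  qed (use L p cond_C_finite_range[OF fr] in \<open>auto simp: add_nonneg_pos\<close>)
qed

text \<open>The count is increasing and minus the void indicator is increasing as well, so their
  nonnegative covariance bounds the moment on the void event from above. Truncation at
  \<open>T\<close> makes both functions bounded, which secures the second moments.\<close>

lemma pos_assoc_void_le:
  assumes pa: "pos_assoc M pp" and q: "0 \<le> q" and T: "0 \<le> T"
    and disj: "cube y r \<inter> cube z l = {}"
  shows "(\<integral>\<^sup>+\<omega>. ennreal (min (real (cnt y r \<omega>)) T powr q) * indicator (void z l) \<omega> \<partial>M)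
    \<le> (\<integral>\<^sup>+\<omega>. ennreal (min (real (cnt y r \<omega>)) T powr q) \<partial>M) * prob (void z l)"
proof -
  define f :: "nat list \<Rightarrow> real" where "f xs = min (real (xs ! 0)) T powr q" for xs
  \<comment> \<open>The value -1 on the void event turns a decreasing indicator into an increasing
    function.\<close>
  define g :: "nat list \<Rightarrow> real" where "g xs = (if xs ! 0 = 0 then - 1 else 0)" for xs
  let ?X = "\<lambda>\<omega>. min (real (cnt y r \<omega>)) T powr q" and ?Y = "indicator (void z l) :: 'w \<Rightarrow> real"
  have X: "(\<lambda>\<omega>. f (map (\<lambda>A. card (pp \<omega> \<inter> A)) [cube y r])) = ?X"
    by (simp add: f_def cnt_def)
  have Y: "g (map (\<lambda>B. card (pp \<omega> \<inter> B)) [cube z l]) = - ?Y \<omega>" if "\<omega> \<in> space M" for \<omega>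
    using that by (simp add: g_def void_def cnt_def indicator_def)
  have X0: "0 \<le> ?X \<omega>" for \<omega> by simp
  have XT: "?X \<omega> \<le> T powr q" for \<omega> using q T by (intro powr_mono2) auto
  have intX: "integrable M ?X"
    by (rule integrable_const_bound[where B = "T powr q"]) (use X0 XT in auto)
  have intXX: "integrable M (\<lambda>\<omega>. (?X \<omega>)\<^sup>2)"
    by (rule integrable_const_bound[where B = "(T powr q)\<^sup>2"]) (use X0 XT in \<open>auto intro: power_mono\<close>)
  have intYY: "integrable M (\<lambda>\<omega>. (g (map (\<lambda>B. card (pp \<omega> \<inter> B)) [cube z l]))\<^sup>2)"
  proof -
    have "(g (map (\<lambda>B. card (pp \<omega> \<inter> B)) [cube z l]))\<^sup>2 = ?Y \<omega>" if "\<omega> \<in> space M" for \<omega>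
      unfolding Y[OF that] by (simp add: indicator_def)
    then have "integrable M (\<lambda>\<omega>. (g (map (\<lambda>B. card (pp \<omega> \<inter> B)) [cube z l]))\<^sup>2) \<longleftrightarrow> integrable M ?Y"
      by (intro Bochner_Integration.integrable_cong refl)
    moreover have "integrable M ?Y"
      by (rule integrable_const_bound[where B = 1]) (auto simp: indicator_def)
    ultimately show ?thesis by blast
  qed
  have mf: "mono_list_fun (length [cube y r]) f"
    using q T by (auto simp: mono_list_fun_def f_def length_Suc_conv intro!: powr_mono2)
  have mg: "mono_list_fun (length [cube z l]) g"
    by (auto simp: mono_list_fun_def g_def length_Suc_conv)
  have dj: "\<forall>i<length ([cube y r] @ [cube z l]). \<forall>j<length ([cube y r] @ [cube z l]). i \<noteq> j \<longrightarrow>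
      ([cube y r] @ [cube z l]) ! i \<inter> ([cube y r] @ [cube z l]) ! j = {}"
    using disj by (auto simp: less_Suc_eq)
  have bd: "\<forall>A\<in>set ([cube y r] @ [cube z l]). A \<in> sets borel \<and> bounded A" by auto
  note pa' = pa[unfolded pos_assoc_def, THEN spec[of _ "[cube y r]"], THEN spec[of _ "[cube z l]"],
    THEN spec[of _ f], THEN spec[of _ g], unfolded Let_def X fun_cong[OF X]]
  have "0 \<le> (\<integral>\<omega>. ?X \<omega> * g (map (\<lambda>B. card (pp \<omega> \<inter> B)) [cube z l]) \<partial>M)
     - (\<integral>\<omega>. ?X \<omega> \<partial>M) * (\<integral>\<omega>. g (map (\<lambda>B. card (pp \<omega> \<inter> B)) [cube z l]) \<partial>M)"
    by (rule mp[OF mp[OF mp[OF mp[OF mp[OF mp[OF pa' bd] dj] mf] mg] intXX] intYY])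
  also have "(\<integral>\<omega>. ?X \<omega> * g (map (\<lambda>B. card (pp \<omega> \<inter> B)) [cube z l]) \<partial>M) = (\<integral>\<omega>. - (?X \<omega> * ?Y \<omega>) \<partial>M)"
    by (intro Bochner_Integration.integral_cong refl) (simp only: Y mult_minus_right)
  also have "(\<integral>\<omega>. g (map (\<lambda>B. card (pp \<omega> \<inter> B)) [cube z l]) \<partial>M) = (\<integral>\<omega>. - ?Y \<omega> \<partial>M)"
    by (intro Bochner_Integration.integral_cong refl) (simp only: Y)
  finally have le: "(\<integral>\<omega>. ?X \<omega> * ?Y \<omega> \<partial>M) \<le> (\<integral>\<omega>. ?X \<omega> \<partial>M) * prob (void z l)" by simp
  have intXY: "integrable M (\<lambda>\<omega>. ?X \<omega> * ?Y \<omega>)"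
    by (rule integrable_const_bound[where B = "T powr q"]) (use X0 XT in \<open>auto simp: indicator_def\<close>)
  have "(\<integral>\<^sup>+\<omega>. ennreal (?X \<omega>) * indicator (void z l) \<omega> \<partial>M) = (\<integral>\<^sup>+\<omega>. ennreal (?X \<omega> * ?Y \<omega>) \<partial>M)"
    by (intro nn_integral_cong) (simp add: indicator_def)
  also have "\<dots> = ennreal (\<integral>\<omega>. ?X \<omega> * ?Y \<omega> \<partial>M)"
    by (rule nn_integral_eq_integral[OF intXY]) auto
  also have "\<dots> \<le> ennreal ((\<integral>\<omega>. ?X \<omega> \<partial>M) * prob (void z l))" by (rule ennreal_leI[OF le])
  also have "\<dots> = (\<integral>\<^sup>+\<omega>. ennreal (?X \<omega>) \<partial>M) * prob (void z l)"
    by (subst nn_integral_eq_integral[OF intX]) (auto simp: ennreal_mult)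
  finally show ?thesis .
qed

lemma void_moment_decay_pos_assoc:
  assumes p: "1 \<le> p" and rho: "rho M pp (1 + p) < \<infinity>" and pa: "pos_assoc M pp"
    and \<alpha>: "real DIM('a) * p < \<alpha>" and C: "cond_C M pp \<alpha>"
  shows "void_moment_decay p"
\<comment> \<open>Positive association asks for disjoint cubes; the separation 1 is a convenient
  choice that ensures this.\<close>
proof (rule void_moment_decay_decoupled[OF p rho _ _ \<alpha> C, of 1])
  fix y z :: 'a and l b assume l: "0 < l" and b: "b \<in> Basis" and far: "l + 1 / 2 + 1 \<le> \<bar>y \<bullet> b - z \<bullet> b\<bar>"
  have disj: "cube y (1/2) \<inter> cube z l = {}"
  proof (rule equals0I)
    fix u assume "u \<in> cube y (1/2) \<inter> cube z l"
    then have "\<bar>u \<bullet> b - y \<bullet> b\<bar> \<le> 1 / 2" "\<bar>u \<bullet> b - z \<bullet> b\<bar> \<le> l" using b by (auto simp: mem_cube)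
    then show False using far by linarith
  qed
  let ?h = "\<lambda>n \<omega>. ennreal (min (real (cnt y (1/2) \<omega>)) (real n) powr (p + 1)) * indicator (void z l) \<omega>"
  have sup: "(SUP n. ?h n \<omega>) = ennreal (real (cnt y (1/2) \<omega>) powr (p + 1)) * indicator (void z l) \<omega>" for \<omega>
  proof (rule antisym)
    show "(SUP n. ?h n \<omega>) \<le> ennreal (real (cnt y (1/2) \<omega>) powr (p + 1)) * indicator (void z l) \<omega>"
      using p by (intro SUP_least mult_right_mono ennreal_leI powr_mono2) auto
    \<comment> \<open>The supremum over truncation levels is attained once the level equals the
      count itself.\<close>
    show "ennreal (real (cnt y (1/2) \<omega>) powr (p + 1)) * indicator (void z l) \<omega> \<le> (SUP n. ?h n \<omega>)"
      by (rule SUP_upper2[of "cnt y (1/2) \<omega>"]) auto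
  qed
  have "(\<integral>\<^sup>+\<omega>. ennreal (real (cnt y (1/2) \<omega>) powr (p + 1)) * indicator (void z l) \<omega> \<partial>M)
    = (\<integral>\<^sup>+\<omega>. (SUP n. ?h n \<omega>) \<partial>M)" unfolding sup ..
  also have "\<dots> = (SUP n. \<integral>\<^sup>+\<omega>. ?h n \<omega> \<partial>M)"
    by (rule nn_integral_monotone_convergence_SUP)
      (use p in \<open>auto simp: incseq_def le_fun_def intro!: mult_right_mono ennreal_leI powr_mono2\<close>)
  also have "\<dots> \<le> rho M pp (1 + p) * prob (void z l)"
  proof (rule SUP_least)
    fix n
    have "(\<integral>\<^sup>+\<omega>. ?h n \<omega> \<partial>M)
      \<le> (\<integral>\<^sup>+\<omega>. ennreal (min (real (cnt y (1/2) \<omega>)) (real n) powr (p + 1)) \<partial>M) * prob (void z l)"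
      by (rule pos_assoc_void_le[OF pa _ _ disj]) (use p in auto)
    also have "\<dots> \<le> rho M pp (1 + p) * prob (void z l)"
      unfolding rho_eq[of _ y] add.commute[of 1 p]
      using p by (intro mult_right_mono nn_integral_mono ennreal_leI powr_mono2) auto
    finally show "(\<integral>\<^sup>+\<omega>. ?h n \<omega> \<partial>M) \<le> rho M pp (1 + p) * prob (void z l)" .
  qed
  finally show "(\<integral>\<^sup>+\<omega>. ennreal (real (cnt y (1/2) \<omega>) powr (p + 1)) * indicator (void z l) \<omega> \<partial>M)
      \<le> rho M pp (1 + p) * prob (void z l)" .
qed simp

end

subsection \<open>Domination of the degree\<close>

text \<open>Common core of (a) and (b), with \<open>f\<close> the conductance or its inverse. The
  weight from Jensen is a power of \<open>W\<close>, hence measurable with respect to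
  \<open>F\<close> and admissible as test function; this exchanges the p-th power of
  \<open>f\<close> for its version \<open>g\<close>, which is at most \<open>C\<close> on the
  neighbours.\<close>

lemma nn_integral_epow_esum_finite:
  fixes nb :: "'w \<Rightarrow> 'a::euclidean_space set"
  assumes p: "1 \<le> p"
    and W: "W \<in> borel_measurable F"
    and nb: "\<And>\<omega>. \<omega> \<in> space P0 \<Longrightarrow> epow (if finite (nb \<omega>) then of_nat (card (nb \<omega>)) else \<infinity>) p \<le> W \<omega>"
    and W': "W \<in> borel_measurable P0" "(\<integral>\<^sup>+\<omega>. W \<omega> \<partial>P0) < \<infinity>"
    and C: "cond_exp_nbr_bounded P0 F nb pp (\<lambda>\<omega> x. epow (f \<omega> x) p) C"
  shows "(\<integral>\<^sup>+\<omega>. epow (esum (nb \<omega>) (f \<omega>)) p \<partial>P0) < \<infinity>"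
proof -
  let ?h = "\<lambda>\<omega> x :: 'a. epow (W \<omega>) ((p - 1) / p)"
  obtain g where eq: "(\<lambda>(\<omega>, x). h \<omega> x) \<in> borel_measurable (F \<Otimes>\<^sub>M borel) \<Longrightarrow>
           (\<integral>\<^sup>+ \<omega>. esum (nb \<omega>) (\<lambda>x. h \<omega> x * epow (f \<omega> x) p) \<partial>P0) =
           (\<integral>\<^sup>+ \<omega>. esum (nb \<omega>) (\<lambda>x. h \<omega> x * g \<omega> x) \<partial>P0)"
      and g: "AE \<omega> in P0. \<forall>x\<in>nb \<omega>. g \<omega> x \<le> ennreal C" for h
    using C unfolding cond_exp_nbr_bounded_def by blast
  have h: "(\<lambda>(\<omega>, x). ?h \<omega> x) \<in> borel_measurable (F \<Otimes>\<^sub>M borel)"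
    using W by measurable
  have "(\<integral>\<^sup>+\<omega>. epow (esum (nb \<omega>) (f \<omega>)) p \<partial>P0)
      \<le> (\<integral>\<^sup>+ \<omega>. esum (nb \<omega>) (\<lambda>x. ?h \<omega> x * epow (f \<omega> x) p) \<partial>P0)"
    by (intro nn_integral_mono epow_esum_le p nb)
  also have "\<dots> = (\<integral>\<^sup>+ \<omega>. esum (nb \<omega>) (\<lambda>x. ?h \<omega> x * g \<omega> x) \<partial>P0)"
    by (rule eq[OF h])
  also have "\<dots> \<le> (\<integral>\<^sup>+ \<omega>. ennreal C * W \<omega> \<partial>P0)"
  proof (rule nn_integral_mono_AE)
    show "AE \<omega> in P0. esum (nb \<omega>) (\<lambda>x. ?h \<omega> x * g \<omega> x) \<le> ennreal C * W \<omega>"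
      using g AE_space
    proof eventually_elim
      case (elim \<omega>)
      have "esum (nb \<omega>) (\<lambda>x. ?h \<omega> x * g \<omega> x) \<le> esum (nb \<omega>) (\<lambda>x. ?h \<omega> x * ennreal C)"
        unfolding esum_def using elim
        by (intro nn_integral_mono) (auto simp: indicator_def intro!: mult_left_mono)
      also have "\<dots> \<le> ennreal C * W \<omega>" using elim by (intro card_mult_epow_le p nb)
      finally show ?case .
    qed
  qed
  also have "\<dots> = ennreal C * (\<integral>\<^sup>+\<omega>. W \<omega> \<partial>P0)" by (rule nn_integral_cmult[OF W'(1)])
  also have "\<dots> < \<infinity>" using W'(2) by (simp add: ennreal_mult_less_top)
  finally show ?thesis .
qed

text \<open>Emptiness is expressed through \<open>card\<close>, so that measurability is inherited
  from the counts; on locally finite configurations the two agree.\<close>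

definition has_hole :: "'a::euclidean_space set \<Rightarrow> real \<Rightarrow> real \<Rightarrow> 'a set \<Rightarrow> bool" where
  "has_hole J \<delta> R \<xi> \<longleftrightarrow> (\<exists>j\<in>J. card (\<xi> \<inter> cube (R *\<^sub>R j) (R * \<delta>)) = 0)"

text \<open>Radius 2^n / 2 means side 2^n, the form that is covered by 2^(dn) unit cubes.\<close>

definition cube_card_powr :: "real \<Rightarrow> nat \<Rightarrow> 'a::euclidean_space set \<Rightarrow> ennreal" where
  "cube_card_powr p n \<xi> = ennreal (real (card (\<xi> \<inter> cube 0 (2 ^ n / 2))) powr p)"

text \<open>The degree is controlled by the number of points in a cube at the first dyadic scale without holes;
  each scale after the first is charged only if the preceding one has a hole.\<close>

definition degree_bound :: "'a::euclidean_space set \<Rightarrow> real \<Rightarrow> nat \<Rightarrow> nat \<Rightarrow> real \<Rightarrow> 'a set \<Rightarrow> ennreal" where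
  "degree_bound J \<delta> t m p \<xi> = cube_card_powr p m \<xi> +
     (\<Sum>n. cube_card_powr p (Suc n + m) \<xi> * (if has_hole J \<delta> (2 ^ (n + t)) \<xi> then 1 else 0))"

lemma term_le_suminf: "f n \<le> (\<Sum>n. f n)" for f :: "nat \<Rightarrow> ennreal"
  using sum_le_suminf[of f "{n}"] by simp

lemma suminf_eq_top:
  fixes f :: "nat \<Rightarrow> ennreal"
  assumes "\<And>n. 1 \<le> f n"
  shows "(\<Sum>n. f n) = top"
proof (rule ccontr)
  assume "(\<Sum>n. f n) \<noteq> top"
  then obtain N where N: "(\<Sum>n. f n) < of_nat N"
    using ennreal_Ex_less_of_nat by (auto simp: less_top)
  have "of_nat N = (\<Sum>n<N. 1 :: ennreal)" by simp
  also have "\<dots> \<le> (\<Sum>n<N. f n)" by (intro sum_mono assms)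
  also have "\<dots> \<le> (\<Sum>n. f n)" by (intro sum_le_suminf) auto
  finally show False using N by simp
qed

lemma dt_deg_le_degree_bound:
  fixes \<xi> :: "'a::euclidean_space set"
  assumes \<xi>: "locfin \<xi>" and p: "1 \<le> p"
    and \<delta>: "\<delta> * (real DIM('a) + 1) \<le> 1" "0 < \<delta>"
    and J: "cube 0 1 \<subseteq> (\<Union>j\<in>J. ball j \<delta>)"
    and m: "4 * real DIM('a) * 2 ^ t \<le> 2 ^ m"
  shows "epow (dt_deg \<xi> 0) p \<le> degree_bound J \<delta> t m p \<xi>"
proof -
  let ?S = "\<lambda>n. cube_card_powr p (Suc n + m) \<xi> * (if has_hole J \<delta> (2 ^ (n + t)) \<xi> then 1 else 0)"
  have deg_le: "epow (dt_deg \<xi> 0) p \<le> cube_card_powr p (n + m) \<xi>" if n: "\<not> has_hole J \<delta> (2 ^ (n + t)) \<xi>" for n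
  proof -
    let ?R = "2 ^ (n + t) :: real"
    have "Vor 0 \<xi> \<subseteq> cube 0 ?R"
      by (rule Vor_subset_cube[OF _ \<delta> J]) (use n in \<open>auto simp: has_hole_def\<close>)
    then have "dt_nbrs \<xi> 0 \<subseteq> \<xi> \<inter> cube 0 (2 * real DIM('a) * ?R)"
      by (rule dt_nbrs_subset_cube)
    \<comment> \<open>The hypothesis on \<open>m\<close> is made for this: the offset m - t absorbs
      the factor 2d and the halving in the radius.\<close>
    also have "2 * real DIM('a) * ?R \<le> 2 ^ (n + m) / 2"
      using mult_left_mono[OF m, of "2 ^ n"] by (simp add: power_add mult_ac)
    then have "\<xi> \<inter> cube 0 (2 * real DIM('a) * ?R) \<subseteq> \<xi> \<inter> cube 0 (2 ^ (n + m) / 2)"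
      using cube_mono by blast
    finally have sub: "dt_nbrs \<xi> 0 \<subseteq> \<xi> \<inter> cube 0 (2 ^ (n + m) / 2)" .
    have fin: "finite (\<xi> \<inter> cube 0 (2 ^ (n + m) / 2))" by (rule locfin_finite[OF \<xi> bounded_cube])
    have "dt_deg \<xi> 0 \<le> of_nat (card (\<xi> \<inter> cube 0 (2 ^ (n + m) / 2)))"
      using card_mono[OF fin sub] finite_subset[OF sub fin] by (simp add: dt_deg_def)
    then have "epow (dt_deg \<xi> 0) p \<le> epow (of_nat (card (\<xi> \<inter> cube 0 (2 ^ (n + m) / 2)))) p"
      using p by (intro epow_mono) auto
    then show ?thesis by (simp add: cube_card_powr_def epow_of_nat)
  qed
  consider (out) "0 \<notin> \<xi>" | (good) "\<exists>n. \<not> has_hole J \<delta> (2 ^ (n + t)) \<xi>"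
    | (bad) "0 \<in> \<xi>" "\<And>n. has_hole J \<delta> (2 ^ (n + t)) \<xi>" by blast
  then show ?thesis
  proof cases
    case out
    then have "dt_nbrs \<xi> 0 = {}" by (auto simp: dt_nbrs_def dt_edge_def)
    then show ?thesis by (simp add: dt_deg_def)
  next
    case good
    define n where "n = (LEAST n. \<not> has_hole J \<delta> (2 ^ (n + t)) \<xi>)"
    have n: "\<not> has_hole J \<delta> (2 ^ (n + t)) \<xi>" unfolding n_def using good by (rule LeastI_ex)
    show ?thesis
    proof (cases n)
      case 0
      then have "epow (dt_deg \<xi> 0) p \<le> cube_card_powr p m \<xi>" using deg_le[OF n] by simp
      then show ?thesis by (simp add: degree_bound_def add_increasing2)
    next
      case (Suc k)
      then have "k < n" by simp
      \<comment> \<open>By minimality of n the preceding scale has a hole, so the summand with index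
        k = n - 1 is present, and its counting cube is the one belonging to scale n.\<close>
      then have "has_hole J \<delta> (2 ^ (k + t)) \<xi>" using not_less_Least n_def by blast
      then have "epow (dt_deg \<xi> 0) p \<le> ?S k" using deg_le[OF n] Suc by simp
      also have "\<dots> \<le> (\<Sum>n. ?S n)" by (rule term_le_suminf)
      finally show ?thesis unfolding degree_bound_def by (simp add: add_increasing)
    qed
  next
    case bad
    \<comment> \<open>With a hole at every scale no summand is suppressed, and each counts at least
      the point 0; the series diverges and the bound is trivial.\<close>
    have "1 \<le> ?S n" for n
    proof -
      have "0 \<in> \<xi> \<inter> cube 0 (2 ^ (Suc n + m) / 2)" using bad by (simp add: mem_cube)
      then have "0 < card (\<xi> \<inter> cube 0 (2 ^ (Suc n + m) / 2))"
        using locfin_finite[OF \<xi> bounded_cube] card_gt_0_iff by blast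
      then have "1 \<le> real (card (\<xi> \<inter> cube 0 (2 ^ (Suc n + m) / 2))) powr p"
        using p by (intro ge_one_powr_ge_zero) auto
      then show ?thesis using bad by (simp add: cube_card_powr_def)
    qed
    then have "(\<Sum>n. ?S n) = top" by (rule suminf_eq_top)
    then show ?thesis by (simp only: degree_bound_def) simp
  qed
qed

text \<open>A shift by a point of the unit cube moves each coordinate by at most 1. Doubling the
  counting cubes and halving the radius of the hole cubes absorbs it, which gives a bound
  independent of \<open>x\<close>, so the Palm sum over \<open>x\<close> becomes a count times one
  function of \<open>\<xi>\<close>.\<close>

lemma degree_bound_translate:
  fixes \<xi> :: "'a::euclidean_space set"
  assumes \<xi>: "locfin \<xi>" and p: "1 \<le> p" and x: "x \<in> unit_cube"
    and t: "2 \<le> 2 ^ t * \<delta>" and m: "1 \<le> m" and \<delta>: "0 < \<delta>"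
  shows "degree_bound J \<delta> t m p ((\<lambda>y. y - x) ` \<xi>) \<le> degree_bound J (\<delta> / 2) t (Suc m) p \<xi>"
proof -
  have x1: "\<bar>x \<bullet> b\<bar> \<le> 1" if "b \<in> Basis" for b
    using x that by (auto simp: unit_cube_def mem_box)
  have card: "cube_card_powr p (n + m) ((\<lambda>y. y - x) ` \<xi>) \<le> cube_card_powr p (n + Suc m) \<xi>" for n
  proof -
    let ?r = "2 ^ (n + m) / 2 :: real"
    have r: "1 \<le> ?r"
    proof -
      have "(2::real) ^ 1 \<le> 2 ^ (n + m)" using m by (intro power_increasing) auto
      then show ?thesis by simp
    qed
    have "cube x ?r \<subseteq> cube 0 (2 ^ (n + Suc m) / 2)"
    proof
      fix z assume z: "z \<in> cube x ?r"
      have "\<bar>z \<bullet> b\<bar> \<le> 2 * ?r" if b: "b \<in> Basis" for b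
      proof -
        have "\<bar>z \<bullet> b - x \<bullet> b\<bar> \<le> ?r" using z b by (simp add: mem_cube)
        then show ?thesis using x1[OF b] r by linarith
      qed
      then show "z \<in> cube 0 (2 ^ (n + Suc m) / 2)" by (simp add: mem_cube)
    qed
    then have "card (\<xi> \<inter> cube x ?r) \<le> card (\<xi> \<inter> cube 0 (2 ^ (n + Suc m) / 2))"
      using locfin_finite[OF \<xi> bounded_cube] by (intro card_mono) auto
    then show ?thesis
      unfolding cube_card_powr_def card_translate_cube using p
      by (intro ennreal_leI powr_mono2) auto
  qed
  have hole: "has_hole J (\<delta> / 2) (2 ^ (n + t)) \<xi>" if h: "has_hole J \<delta> (2 ^ (n + t)) ((\<lambda>y. y - x) ` \<xi>)" for n
  proof -
    let ?R = "2 ^ (n + t) :: real"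
    obtain j where j: "j \<in> J" "card (\<xi> \<inter> cube (?R *\<^sub>R j + x) (?R * \<delta>)) = 0"
      using h unfolding has_hole_def card_translate_cube by blast
    have R: "2 \<le> ?R * \<delta>"
    proof -
      have "1 * (2 ^ t * \<delta>) \<le> 2 ^ n * (2 ^ t * \<delta>)" using \<delta> by (intro mult_right_mono) auto
      then show ?thesis using t by (simp add: power_add mult_ac)
    qed
    have "cube (?R *\<^sub>R j) (?R * (\<delta> / 2)) \<subseteq> cube (?R *\<^sub>R j + x) (?R * \<delta>)"
    proof
      fix z assume z: "z \<in> cube (?R *\<^sub>R j) (?R * (\<delta> / 2))"
      show "z \<in> cube (?R *\<^sub>R j + x) (?R * \<delta>)"
        unfolding mem_cube
      proof
        fix b :: 'a assume b: "b \<in> Basis"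
        have "\<bar>z \<bullet> b - (?R *\<^sub>R j) \<bullet> b\<bar> \<le> ?R * \<delta> / 2" using z b by (simp add: mem_cube)
        then show "\<bar>z \<bullet> b - (?R *\<^sub>R j + x) \<bullet> b\<bar> \<le> ?R * \<delta>"
          using R x1[OF b] unfolding inner_add_left by linarith
      qed
    qed
    then have "card (\<xi> \<inter> cube (?R *\<^sub>R j) (?R * (\<delta> / 2))) \<le> card (\<xi> \<inter> cube (?R *\<^sub>R j + x) (?R * \<delta>))"
      using locfin_finite[OF \<xi> bounded_cube] by (intro card_mono) auto
    then show ?thesis using j unfolding has_hole_def by auto
  qed
  show ?thesis
    unfolding degree_bound_def
    using card[of 0] card[of "Suc _"] hole
    by (intro add_mono suminf_le mult_mono) auto
qed

lemma degree_bound_measurable: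
  fixes J :: "'a::euclidean_space set"
  assumes J: "finite J"
  shows "degree_bound J \<delta> t m p \<in> borel_measurable Nspace"
proof -
  have [measurable]: "(\<lambda>\<xi>. card (\<xi> \<inter> cube y r)) \<in> measurable Nspace (count_space UNIV)" for y :: 'a and r
    by (rule measurable_card_Nspace) auto
  have [measurable]: "Measurable.pred Nspace (has_hole J \<delta> R)" for \<delta> R
    unfolding has_hole_def using J by measurable
  show ?thesis
    unfolding degree_bound_def[abs_def] cube_card_powr_def by measurable
qed

section \<open>Integrability of the degree bound under the Palm measure\<close>

context stationary_point_process
begin

lemma rho_mono_less_top:
  assumes "0 \<le> q" "q \<le> \<gamma>" "rho M pp \<gamma> < \<infinity>"
  shows "rho M pp q < \<infinity>"
proof -
  have "rho M pp q \<le> (\<integral>\<^sup>+\<omega>. 1 + ennreal (real (cnt 0 (1/2) \<omega>) powr \<gamma>) \<partial>M)"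
    unfolding rho_eq[of _ 0]
  proof (rule nn_integral_mono)
    fix \<omega>
    let ?x = "real (cnt 0 (1/2) \<omega>)"
    have "?x powr q \<le> 1 + ?x powr \<gamma>"
    proof (cases "cnt 0 (1/2) \<omega> = 0")
      case False
      then have "?x powr q \<le> ?x powr \<gamma>" using assms by (intro powr_mono) auto
      then show ?thesis by simp
    qed simp
    then have "ennreal (?x powr q) \<le> ennreal (1 + ?x powr \<gamma>)" by (rule ennreal_leI)
    then show "ennreal (?x powr q) \<le> 1 + ennreal (?x powr \<gamma>)" by simp
  qed
  also have "\<dots> = 1 + rho M pp \<gamma>"
    unfolding rho_eq[of _ 0] by (subst nn_integral_add) (auto simp: emeasure_space_1)
  also have "\<dots> < \<infinity>" using assms by simp
  finally show ?thesis .
qed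

lemma rho_less_top_and_void_moment_decay:
  assumes p: "1 \<le> p"
    and C: "(\<exists>\<gamma>. \<gamma> > p + 1 \<and> rho M pp \<gamma> < \<infinity> \<and>
               (\<exists>\<alpha>. \<alpha> > real DIM('a) * p * \<gamma> / (\<gamma> - 1 - p) \<and> cond_C M pp \<alpha>))
          \<or> (rho M pp (1 + p) < \<infinity> \<and> finite_range_dep M pp)
          \<or> (rho M pp (1 + p) < \<infinity> \<and> pos_assoc M pp \<and>
               (\<exists>\<alpha>. \<alpha> > real DIM('a) * p \<and> cond_C M pp \<alpha>))"
  shows "rho M pp (1 + p) < \<infinity> \<and> void_moment_decay p"
proof -
  consider (1) \<gamma> \<alpha> where "p + 1 < \<gamma>" "rho M pp \<gamma> < \<infinity>"
      "real DIM('a) * p * \<gamma> / (\<gamma> - 1 - p) < \<alpha>" "cond_C M pp \<alpha>"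
    | (2) "rho M pp (1 + p) < \<infinity>" "finite_range_dep M pp"
    | (3) \<alpha> where "rho M pp (1 + p) < \<infinity>" "pos_assoc M pp" "real DIM('a) * p < \<alpha>" "cond_C M pp \<alpha>"
    using C by metis
  then show ?thesis
  proof cases
    case 1
    then show ?thesis
      using p rho_mono_less_top[of "1 + p" \<gamma>] void_moment_decay_moments[OF p, of \<gamma> \<alpha>] by simp
  next
    case 2
    then show ?thesis using void_moment_decay_finite_range[OF p] by simp
  next
    case 3
    then show ?thesis using void_moment_decay_pos_assoc[OF p, of \<alpha>] by simp
  qed
qed

text \<open>At scale n the covering costs 2^(dpn) while the void event gains
  2^(-\<open>\<beta>\<close> n), up to constants. The series is therefore dominated by a geometric
  one.\<close>

lemma nn_integral_cnt_degree_bound_finite: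
  assumes p: "1 \<le> p" and rho: "rho M pp (1 + p) < \<infinity>" and J: "finite J" and \<delta>: "0 < \<delta>"
    and \<beta>: "real DIM('a) * p < \<beta>" and K: "0 \<le> K"
    and decay: "\<And>y z l. l0 \<le> l \<Longrightarrow>
      (\<integral>\<^sup>+\<omega>. ennreal (real (cnt y (1/2) \<omega>) powr (p + 1)) * indicator (void z l) \<omega> \<partial>M)
       \<le> ennreal (K * l powr (- \<beta>))"
    and t: "l0 \<le> 2 ^ t * \<delta>"
  shows "(\<integral>\<^sup>+\<omega>. of_nat (cnt u (1/2) \<omega>) * degree_bound J \<delta> t m p (pp \<omega>) \<partial>M) < \<infinity>"
proof -
  let ?d = "real DIM('a)"
  let ?c = "\<lambda>\<omega>. of_nat (cnt u (1/2) \<omega>) :: ennreal"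
  let ?a = "\<lambda>k \<omega>. ennreal (real (cnt 0 (2 ^ k / 2) \<omega>) powr p)"
  let ?v = "\<lambda>n j. void (2 ^ (n + t) *\<^sub>R j) (2 ^ (n + t) * \<delta>)"
  obtain \<rho> where \<rho>: "rho M pp (1 + p) = ennreal \<rho>" "0 \<le> \<rho>" using rho by (cases "rho M pp (1 + p)") auto
  \<comment> \<open>The first summand carries no void event; it is the same estimate with the whole
    space in place of \<open>E\<close>, and the moment of order p + 1 suffices.\<close>
  have zero: "(\<integral>\<^sup>+\<omega>. ?c \<omega> * ?a m \<omega> * indicator (space M) \<omega> \<partial>M) < \<infinity>"
  proof (rule le_less_trans[OF nn_integral_cnt_mult_powr_le[OF p _ _ \<rho>(2)]])
    show "(\<integral>\<^sup>+\<omega>. ennreal (real (cnt y (1/2) \<omega>) powr (p + 1)) * indicator (space M) \<omega> \<partial>M) \<le> ennreal \<rho>" for y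
      by (simp add: \<rho>(1)[symmetric] rho_eq[of _ y] add.commute cong: nn_integral_cong)
  qed auto
  \<comment> \<open>\<open>A\<close> collects the factors that do not depend on the scale n, and
    \<open>q\<close> below is the ratio between consecutive scales.\<close>
  define A where "A = real (card J) * (2 * 2 powr (?d * p * (1 + real m)) * K * (2 ^ t * \<delta>) powr (- \<beta>))"
  have A0: "0 \<le> A" using K by (simp add: A_def)
  define q where "q = 2 powr (?d * p - \<beta>)"
  have q: "0 \<le> q" "q < 1" using \<beta> by (auto simp: q_def powr_less_one)
  have scale: "(\<Sum>j\<in>J. \<integral>\<^sup>+\<omega>. ?c \<omega> * ?a (Suc n + m) \<omega> * indicator (?v n j) \<omega> \<partial>M) \<le> ennreal (A * q ^ n)" for n
  proof -
    have l: "l0 \<le> 2 ^ (n + t) * \<delta>"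
    proof -
      have "1 * (2 ^ t * \<delta>) \<le> 2 ^ n * (2 ^ t * \<delta>)" using \<delta> by (intro mult_right_mono) auto
      then show ?thesis using t by (simp add: power_add mult_ac)
    qed
    let ?B = "2 * (2 ^ (DIM('a) * (Suc n + m))) powr p * (K * (2 ^ (n + t) * \<delta>) powr (- \<beta>))"
    have pow: "(2 :: real) ^ k = 2 powr real k" for k by (simp add: powr_realpow)
    have "(2 ^ (DIM('a) * (Suc n + m))) powr p = 2 powr (?d * (1 + real n + real m) * p)"
      unfolding pow powr_powr by (simp add: algebra_simps)
    also have "\<dots> = 2 powr (?d * p * (1 + real m)) * 2 powr (?d * p * real n)"
      unfolding powr_add[symmetric] by (simp add: algebra_simps)
    finally have e1: "(2 ^ (DIM('a) * (Suc n + m))) powr p = 2 powr (?d * p * (1 + real m)) * 2 powr (?d * p * real n)" .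
    have "(2 ^ (n + t) * \<delta>) powr (- \<beta>) = (2 ^ n * (2 ^ t * \<delta>)) powr (- \<beta>)"
      by (simp add: power_add mult.assoc)
    also have "\<dots> = (2 ^ n) powr (- \<beta>) * (2 ^ t * \<delta>) powr (- \<beta>)"
      by (rule powr_mult)
    also have "(2 ^ n) powr (- \<beta>) = 2 powr (- \<beta> * real n)"
      unfolding pow powr_powr by (simp only: mult.commute)
    finally have e2: "(2 ^ (n + t) * \<delta>) powr (- \<beta>) = 2 powr (- \<beta> * real n) * (2 ^ t * \<delta>) powr (- \<beta>)" .
    have "q ^ n = 2 powr ((?d * p - \<beta>) * real n)"
      by (simp add: q_def powr_power mult.commute)
    also have "\<dots> = 2 powr (?d * p * real n) * 2 powr (- \<beta> * real n)"
      unfolding powr_add[symmetric] by (simp add: left_diff_distrib)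
    finally have e3: "q ^ n = 2 powr (?d * p * real n) * 2 powr (- \<beta> * real n)" .
    have "(\<Sum>j\<in>J. \<integral>\<^sup>+\<omega>. ?c \<omega> * ?a (Suc n + m) \<omega> * indicator (?v n j) \<omega> \<partial>M) \<le> (\<Sum>j\<in>J. ennreal ?B)"
      using K by (intro sum_mono nn_integral_cnt_mult_powr_le p decay l) auto
    also have "\<dots> = ennreal (real (card J) * ?B)"
      using K by (simp add: ennreal_mult ennreal_of_nat_eq_real_of_nat)
    also have "real (card J) * ?B = A * q ^ n"
      unfolding e1 e2 e3 A_def by (simp only: mult_ac)
    finally show ?thesis .
  qed
  have "(\<integral>\<^sup>+\<omega>. ?c \<omega> * degree_bound J \<delta> t m p (pp \<omega>) \<partial>M)
    \<le> (\<integral>\<^sup>+\<omega>. ?c \<omega> * ?a m \<omega> * indicator (space M) \<omega> +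
        (\<Sum>n. \<Sum>j\<in>J. ?c \<omega> * ?a (Suc n + m) \<omega> * indicator (?v n j) \<omega>) \<partial>M)"
  proof (rule nn_integral_mono)
    fix \<omega> assume \<omega>: "\<omega> \<in> space M"
    \<comment> \<open>Union bound over the finitely many grid cubes, whose number does not depend on
      n.\<close>
    have hole: "(if has_hole J \<delta> (2 ^ (n + t)) (pp \<omega>) then 1 else 0) \<le> (\<Sum>j\<in>J. indicator (?v n j) \<omega> :: ennreal)" for n
    proof (cases "has_hole J \<delta> (2 ^ (n + t)) (pp \<omega>)")
      case True
      then obtain j where j: "j \<in> J" "\<omega> \<in> ?v n j" using \<omega> by (auto simp: has_hole_def void_def cnt_def)
      have "1 = (indicator (?v n j) \<omega> :: ennreal)" using j by simp
      also have "\<dots> \<le> (\<Sum>j\<in>J. indicator (?v n j) \<omega>)" using J j by (intro member_le_sum) auto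
      finally show ?thesis using True by simp
    qed simp
    have "?c \<omega> * degree_bound J \<delta> t m p (pp \<omega>) = ?c \<omega> * ?a m \<omega> +
      (\<Sum>n. ?c \<omega> * ?a (Suc n + m) \<omega> * (if has_hole J \<delta> (2 ^ (n + t)) (pp \<omega>) then 1 else 0))"
      by (simp only: degree_bound_def cube_card_powr_def cnt_def[symmetric] distrib_left
        ennreal_suminf_cmult mult.assoc)
    also have "\<dots> \<le> ?c \<omega> * ?a m \<omega> * indicator (space M) \<omega> +
        (\<Sum>n. \<Sum>j\<in>J. ?c \<omega> * ?a (Suc n + m) \<omega> * indicator (?v n j) \<omega>)"
      unfolding sum_distrib_left[symmetric] using \<omega>
      by (intro add_mono suminf_le mult_left_mono hole) auto
    finally show "?c \<omega> * degree_bound J \<delta> t m p (pp \<omega>) \<le> \<dots>" .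
  qed
  also have "\<dots> = (\<integral>\<^sup>+\<omega>. ?c \<omega> * ?a m \<omega> * indicator (space M) \<omega> \<partial>M) +
     (\<Sum>n. \<Sum>j\<in>J. \<integral>\<^sup>+\<omega>. ?c \<omega> * ?a (Suc n + m) \<omega> * indicator (?v n j) \<omega> \<partial>M)"
    by (subst nn_integral_add, measurable) (simp add: nn_integral_suminf nn_integral_sum)
  also have "\<dots> \<le> (\<integral>\<^sup>+\<omega>. ?c \<omega> * ?a m \<omega> * indicator (space M) \<omega> \<partial>M) + (\<Sum>n. ennreal (A * q ^ n))"
    by (intro add_left_mono suminf_le scale) auto
  also have "\<dots> < \<infinity>"
  proof -
    have "summable (\<lambda>n. A * q ^ n)" using q by (intro summable_mult summable_geometric) auto
    then have "(\<Sum>n. ennreal (A * q ^ n)) = ennreal (\<Sum>n. A * q ^ n)"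
      using A0 q by (intro suminf_ennreal2) auto
    then show ?thesis using zero by simp
  qed
  finally show ?thesis .
qed

text \<open>The statement is uniform in \<open>t\<close> and \<open>m\<close> because
  \<open>m\<close> has to be chosen afterwards, depending on \<open>t\<close>.\<close>

lemma nn_integral_palm_degree_bound_finite:
  assumes p: "1 \<le> p" and rho: "rho M pp (1 + p) < \<infinity>" and decay: "void_moment_decay p"
    and int: "0 < intensity M pp" and J: "finite J" and \<delta>: "0 < \<delta>"
  shows "\<exists>t0. \<forall>t\<ge>t0. \<forall>m\<ge>1.
    (\<integral>\<^sup>+\<omega>. degree_bound J \<delta> t m p (pp \<omega>) \<partial>palm M pp \<theta>) < \<infinity>"
proof -
  obtain \<beta> K l0 where \<beta>: "real DIM('a) * p < \<beta>" and K: "0 \<le> K" and l0: "1 \<le> l0"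
    and dec: "\<And>y z l. l0 \<le> l \<Longrightarrow>
      (\<integral>\<^sup>+\<omega>. ennreal (real (cnt y (1/2) \<omega>) powr (p + 1)) * indicator (void z l) \<omega> \<partial>M)
       \<le> ennreal (K * l powr (- \<beta>))"
    using decay unfolding void_moment_decay_def by blast
  \<comment> \<open>The factor 2 compensates the halved hole radius after translation; since
    \<open>l0\<close> is at least 1, it also yields the lower bound 2 that the translation lemma
    asks for.\<close>
  obtain t0 where t0: "2 * l0 / \<delta> < 2 ^ t0" using real_arch_pow[of 2 "2 * l0 / \<delta>"] by auto
  show ?thesis
  proof (intro exI[of _ t0] allI impI)
    fix t m :: nat assume tt: "t0 \<le> t" and m: "1 \<le> m"
    have "(2::real) ^ t0 \<le> 2 ^ t" using tt by (intro power_increasing) auto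
    then have "2 * l0 / \<delta> \<le> 2 ^ t" using t0 by linarith
    then have t: "2 * l0 \<le> 2 ^ t * \<delta>" using \<delta> by (simp add: pos_divide_le_eq)
    let ?W = "\<lambda>\<omega>. degree_bound J \<delta> t m p (pp \<omega>)"
    let ?W' = "\<lambda>\<omega>. degree_bound J (\<delta> / 2) t (Suc m) p (pp \<omega>)"
    let ?u = "(1/2) *\<^sub>R One :: 'a"
    have "?W \<in> borel_measurable M"
      by (rule measurable_compose[OF pp_measurable degree_bound_measurable[OF J]])
    then have "(\<integral>\<^sup>+\<omega>. ?W \<omega> \<partial>palm M pp \<theta>)
      \<le> (\<integral>\<^sup>+\<omega>. (\<Sum>x\<in>pp \<omega> \<inter> unit_cube. ?W (\<theta> x \<omega>)) \<partial>M) / intensity M pp"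
      by (rule nn_integral_palm_le) (rule measurable_space[OF theta_measurable])
    also have "\<dots> \<le> (\<integral>\<^sup>+\<omega>. of_nat (cnt ?u (1/2) \<omega>) * ?W' \<omega> \<partial>M) / intensity M pp"
    proof (intro divide_right_mono_ennreal nn_integral_mono_AE)
      show "AE \<omega> in M. (\<Sum>x\<in>pp \<omega> \<inter> unit_cube. ?W (\<theta> x \<omega>)) \<le> of_nat (cnt ?u (1/2) \<omega>) * ?W' \<omega>"
        using covariant AE_space
      proof eventually_elim
        case (elim \<omega>)
        have "?W (\<theta> x \<omega>) \<le> ?W' \<omega>" if "x \<in> pp \<omega> \<inter> unit_cube" for x
          using elim that t l0 m \<delta> p locfin_pp
          by (simp, intro degree_bound_translate) auto
        then have "(\<Sum>x\<in>pp \<omega> \<inter> unit_cube. ?W (\<theta> x \<omega>)) \<le> of_nat (card (pp \<omega> \<inter> unit_cube)) * ?W' \<omega>"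
          by (rule sum_bounded_above)
        then show ?case by (simp add: cnt_def unit_cube_eq_cube)
      qed
    qed
    also have "\<dots> < \<infinity>"
    proof -
      have "(\<integral>\<^sup>+\<omega>. of_nat (cnt ?u (1/2) \<omega>) * ?W' \<omega> \<partial>M) < \<infinity>"
        by (rule nn_integral_cnt_degree_bound_finite[OF p rho J _ \<beta> K dec]) (use \<delta> t in auto)
      then show ?thesis using int by (auto simp: less_top[symmetric] ennreal_divide_eq_top_iff)
    qed
    finally show "(\<integral>\<^sup>+\<omega>. ?W \<omega> \<partial>palm M pp \<theta>) < \<infinity>" .
  qed
qed

end

section \<open>Moments of the degree and of the conductance sums\<close>

theorem theorem4p13:
  fixes M :: "'w measure"
    and \<theta> :: "'a::euclidean_space \<Rightarrow> 'w \<Rightarrow> 'w"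
    and pp :: "'w \<Rightarrow> 'a set"
    and c :: "'w \<Rightarrow> 'a \<Rightarrow> 'a \<Rightarrow> real"
    and p :: real
  assumes p: "1 \<le> p"
    and prob: "prob_space M"
    \<comment> \<open>measurable R^d-action\<close>
    and theta_meas: "(\<lambda>(x, \<omega>). \<theta> x \<omega>) \<in> measurable (borel \<Otimes>\<^sub>M M) M"
    and theta_0: "\<And>\<omega>. \<omega> \<in> space M \<Longrightarrow> \<theta> 0 \<omega> = \<omega>"
    and theta_add: "\<And>x y \<omega>. \<omega> \<in> space M \<Longrightarrow> \<theta> (x + y) \<omega> = \<theta> x (\<theta> y \<omega>)"
    \<comment> \<open>simple point process omega \<mapsto> hat omega with values in N\<close>
    and pp_meas: "pp \<in> measurable M Nspace"
    \<comment> \<open>measurable symmetric conductances supported on DT edges\<close>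
    and c_meas: "(\<lambda>(\<omega>, x, y). c \<omega> x y) \<in> borel_measurable (M \<Otimes>\<^sub>M (borel \<Otimes>\<^sub>M borel))"
    and c_nonneg: "\<And>\<omega> x y. \<omega> \<in> space M \<Longrightarrow> 0 \<le> c \<omega> x y"
    and c_sym: "\<And>\<omega> x y. \<omega> \<in> space M \<Longrightarrow> c \<omega> x y = c \<omega> y x"
    and c_diag: "\<And>\<omega> x. \<omega> \<in> space M \<Longrightarrow> c \<omega> x x = 0"
    and c_supp: "\<And>\<omega> x y. \<omega> \<in> space M \<Longrightarrow> \<not> dt_edge (pp \<omega>) x y \<Longrightarrow> c \<omega> x y = 0"
    \<comment> \<open>(A1)\<close>
    and A1_inv: "\<And>x. distr M M (\<theta> x) = M"
    and A1_nonempty: "AE \<omega> in M. pp \<omega> \<noteq> {}"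
    \<comment> \<open>(A2)\<close>
    and A2: "0 < intensity M pp" "intensity M pp < \<infinity>"
    \<comment> \<open>(A3)\<close>
    and A3: "\<exists>\<Omega>s \<in> sets M. emeasure M \<Omega>s = 1 \<and>
              (\<forall>x. \<forall>\<omega>\<in>space M. \<theta> x \<omega> \<in> \<Omega>s \<longleftrightarrow> \<omega> \<in> \<Omega>s) \<and>
              (\<forall>\<omega>\<in>\<Omega>s. \<forall>x. pp (\<theta> x \<omega>) = (\<lambda>y. y - x) ` pp \<omega> \<and>
                 (\<forall>y z. dt_edge (pp \<omega>) y z \<longrightarrow> c (\<theta> x \<omega>) (y - x) (z - x) = c \<omega> y z))"
    \<comment> \<open>(C1) or (C2) or (C3)\<close>
    and C: "(\<exists>\<gamma>. \<gamma> > p + 1 \<and> rho M pp \<gamma> < \<infinity> \<and>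
               (\<exists>\<alpha>. \<alpha> > real DIM('a) * p * \<gamma> / (\<gamma> - 1 - p) \<and> cond_C M pp \<alpha>))
          \<or> (rho M pp (1 + p) < \<infinity> \<and> finite_range_dep M pp)
          \<or> (rho M pp (1 + p) < \<infinity> \<and> pos_assoc M pp \<and>
               (\<exists>\<alpha>. \<alpha> > real DIM('a) * p \<and> cond_C M pp \<alpha>))"
  shows "(\<integral>\<^sup>+ \<omega>. epow (dt_deg (pp \<omega>) 0) p \<partial>palm M pp \<theta>) < \<infinity>
     \<and> ((\<exists>C\<ge>0. cond_exp_nbr_bounded (palm M pp \<theta>) (vimage_algebra (space M) pp Nspace)
                   (\<lambda>\<omega>. dt_nbrs (pp \<omega>) 0) pp (\<lambda>\<omega> x. epow (ennreal (c \<omega> 0 x)) p) C)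
        \<longrightarrow> (\<integral>\<^sup>+ \<omega>. epow (esum (dt_nbrs (pp \<omega>) 0) (\<lambda>x. ennreal (c \<omega> 0 x))) p \<partial>palm M pp \<theta>) < \<infinity>)
     \<and> ((\<exists>C\<ge>0. cond_exp_nbr_bounded (palm M pp \<theta>) (vimage_algebra (space M) pp Nspace)
                   (\<lambda>\<omega>. dt_nbrs (pp \<omega>) 0) pp (\<lambda>\<omega> x. epow (inverse (ennreal (c \<omega> 0 x))) p) C)
        \<longrightarrow> (\<integral>\<^sup>+ \<omega>. epow (esum (dt_nbrs (pp \<omega>) 0) (\<lambda>x. inverse (ennreal (c \<omega> 0 x)))) p \<partial>palm M pp \<theta>) < \<infinity>)"
proof -
  interpret prob_space M by (rule prob)
  obtain \<Omega>s where \<Omega>s: "\<Omega>s \<in> sets M" "emeasure M \<Omega>s = 1"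
    and cov: "\<And>\<omega> x. \<omega> \<in> \<Omega>s \<Longrightarrow> pp (\<theta> x \<omega>) = (\<lambda>y. y - x) ` pp \<omega>"
    using A3 by (elim bexE conjE) simp
  have "AE \<omega> in M. \<omega> \<in> \<Omega>s"
    using \<Omega>s by (subst AE_in_set_eq_1) (auto simp: measure_def)
  interpret stationary_point_process M \<theta> pp
  proof
    \<comment> \<open>A section of the jointly measurable action at fixed \<open>x\<close>.\<close>
    show "\<theta> x \<in> measurable M M" for x
      using measurable_compose[OF measurable_Pair1' theta_meas, of x] by simp
    show "AE \<omega> in M. \<forall>x. pp (\<theta> x \<omega>) = (\<lambda>y. y - x) ` pp \<omega>"
      using \<open>AE \<omega> in M. \<omega> \<in> \<Omega>s\<close> by eventually_elim (rule allI, rule cov)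
  qed (fact pp_meas A1_inv A1_nonempty)+
  note rho = conjunct1[OF rho_less_top_and_void_moment_decay[OF p C]]
    and decay = conjunct2[OF rho_less_top_and_void_moment_decay[OF p C]]
  define \<delta> where "\<delta> = 1 / (real DIM('a) + 1)"
  have \<delta>: "\<delta> * (real DIM('a) + 1) \<le> 1" "0 < \<delta>" by (auto simp: \<delta>_def add_pos_nonneg)
  obtain J :: "'a set" where J: "finite J" "cube 0 1 \<subseteq> (\<Union>j\<in>J. ball j \<delta>)"
    by (rule cube_finite_cover[OF \<delta>(2)])
  obtain t where t: "\<forall>s\<ge>t. \<forall>m\<ge>1.
      (\<integral>\<^sup>+\<omega>. degree_bound J \<delta> s m p (pp \<omega>) \<partial>palm M pp \<theta>) < \<infinity>"
    using nn_integral_palm_degree_bound_finite[OF p rho decay A2(1) J(1) \<delta>(2)] by (rule exE)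
  \<comment> \<open>The counting scale must dominate the hole scale by a factor 4d, so it is fixed
    only after \<open>t\<close>; taking the successor ensures m >= 1.\<close>
  obtain m0 where m0: "4 * real DIM('a) * 2 ^ t < 2 ^ m0"
    using real_arch_pow[of 2 "4 * real DIM('a) * 2 ^ t"] by auto
  define m where "m = Suc m0"
  have "(2::real) ^ m0 \<le> 2 ^ m" by (simp add: m_def)
  then have m: "4 * real DIM('a) * 2 ^ t \<le> 2 ^ m" using m0 by linarith
  let ?P = "palm M pp \<theta>" and ?W = "\<lambda>\<omega>. degree_bound J \<delta> t m p (pp \<omega>)"
  have sets: "sets ?P = sets M" and space: "space ?P = space M"
    by (auto simp: palm_def sets.space_closed)
  have deg: "epow (dt_deg (pp \<omega>) 0) p \<le> ?W \<omega>" if "\<omega> \<in> space ?P" for \<omega>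
    using that by (intro dt_deg_le_degree_bound locfin_pp p \<delta> J m) (simp add: space)
  have fin: "(\<integral>\<^sup>+\<omega>. ?W \<omega> \<partial>?P) < \<infinity>" by (rule t[rule_format]) (simp_all add: m_def)
  have "?W \<in> borel_measurable M"
    by (rule measurable_compose[OF pp_measurable degree_bound_measurable[OF J(1)]])
  then have W: "?W \<in> borel_measurable ?P"
    by (subst measurable_cong_sets[OF sets refl])
  have "pp \<in> measurable (vimage_algebra (space M) pp Nspace) Nspace"
    by (rule measurable_vimage_algebra1) (use measurable_space[OF pp_meas] in auto)
  \<comment> \<open>The bound depends on \<open>\<omega>\<close> through the configuration alone,
    which is what makes it usable as a test function given \<open>pp\<close>.\<close>
  then have WF: "?W \<in> borel_measurable (vimage_algebra (space M) pp Nspace)"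
    by (rule measurable_compose[OF _ degree_bound_measurable[OF J(1)]])
  have *: "(\<integral>\<^sup>+ \<omega>. epow (esum (dt_nbrs (pp \<omega>) 0) (f \<omega>)) p \<partial>?P) < \<infinity>"
    if "cond_exp_nbr_bounded ?P (vimage_algebra (space M) pp Nspace)
      (\<lambda>\<omega>. dt_nbrs (pp \<omega>) 0) pp (\<lambda>\<omega> x. epow (f \<omega> x) p) C" for f C
    by (rule nn_integral_epow_esum_finite[OF p WF _ W fin that]) (rule deg[unfolded dt_deg_def])
  have "(\<integral>\<^sup>+ \<omega>. epow (dt_deg (pp \<omega>) 0) p \<partial>?P) \<le> (\<integral>\<^sup>+\<omega>. ?W \<omega> \<partial>?P)"
    by (intro nn_integral_mono deg)
  also note fin
  finally have E: "(\<integral>\<^sup>+ \<omega>. epow (dt_deg (pp \<omega>) 0) p \<partial>?P) < \<infinity>" .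
  show ?thesis by (intro conjI impI E; (elim exE conjE, erule *))
qed

end
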